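(* Let $\Gamma$ be a finite connected graph and let $\mathcal{A}$ be a family of subgroups of the right-angled Artin group $A(\Gamma)$ such that $\mathcal{A}$ is closed under taking subgroups. If $A(\Gamma)$ has a non-trivial $\mathcal{A}$-splitting, then either there exists a homomorphism $\phi\colon A(\Gamma)\to\mathbb{Z}$ with $\ker(\phi)\in\mathcal{A}$, or $\Gamma$ has a separating subgraph $\Lambda$ such that $A(\Lambda)\in\mathcal{A}$.
   Context: For a graph $\Gamma$ with vertex set $V(\Gamma)$ and edge set $E(\Gamma)$, the right-angled Artin group $A(\Gamma)$ is the group given by the presentation $\langle V(\Gamma)\mid [u,v]=1 \text{ whenever } (u,v)\in E(\Gamma)\rangle$. For an induced subgraph $\Lambda$ of $\Gamma$, $A(\Lambda)$ is identified with the subgroup of $A(\Gamma)$ generated by the vertices of $\Lambda$. A separating subgraph of $\Gamma$ is an induced subgraph $\Lambda$ such that $\Gamma\setminus\Lambda$ (the subgraph induced on the vertices not in $\Lambda$) is disconnected, i.e. has at least two connected components. A splitting of a group $G$ is a graph of groups decomposition of $G$. By Bass-Serre theory, this corresponds to an action of $G$ (without inversions) on a simplicial tree $T$, the Bass-Serre tree of the splitting, where the edge groups are the stabilizers in $G$ of edges of $T$. The splitting is non-trivial if this action is non-trivial, meaning that no point of $T$ is fixed by all elements of $G$. For a family $\mathcal{A}$ of subgroups of $G$, an $\mathcal{A}$-splitting of $G$ is a splitting all of whose edge groups belong to $\mathcal{A}$, where the edge groups are understood as the stabilizers of all edges of the Bass-Serre tree $T$. The family $\mathcal{A}$ being closed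 under taking subgroups means that if $H\in\mathcal{A}$ and $K\leq H$ then $K\in\mathcal{A}$. *)

theory Defs
  imports
    Complex_Main
    "HOL-Algebra.Generated_Groups"
    "HOL-Algebra.Group_Action"
    "HOL-Algebra.Elementary_Groups"
    "Graph_Theory.Graph_Theory"
begin

section \<open>Groups given by presentations\<close>

text \<open>The letter \<open>(x, True)\<close> stands for the generator \<open>x\<close>, and \<open>(x, False)\<close> for its
  formal inverse.\<close>

type_synonym 'v word = "('v \<times> bool) list"

definition words :: "'v set \<Rightarrow> 'v word set" where
  "words S = lists (S \<times> UNIV)"

inductive pres_eq :: "'v set \<Rightarrow> 'v word set \<Rightarrow> 'v word \<Rightarrow> 'v word \<Rightarrow> bool"
  for S :: "'v set" and R :: "'v word set" where
  refl: "w \<in> words S \<Longrightarrow> pres_eq S R w w"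
| sym: "pres_eq S R u w \<Longrightarrow> pres_eq S R w u"
| trans: "pres_eq S R u v \<Longrightarrow> pres_eq S R v w \<Longrightarrow> pres_eq S R u w"
| cancel: "u \<in> words S \<Longrightarrow> w \<in> words S \<Longrightarrow> x \<in> S \<Longrightarrow>
    pres_eq S R (u @ [(x, b), (x, \<not> b)] @ w) (u @ w)"
| relator: "u \<in> words S \<Longrightarrow> w \<in> words S \<Longrightarrow> r \<in> R \<Longrightarrow> r \<in> words S \<Longrightarrow>
    pres_eq S R (u @ r @ w) (u @ w)"

definition pres_rel :: "'v set \<Rightarrow> 'v word set \<Rightarrow> ('v word \<times> 'v word) set" where
  "pres_rel S R = {(u, w). pres_eq S R u w}"

definition presented_group :: "'v set \<Rightarrow> 'v word set \<Rightarrow> 'v word set monoid" where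
  "presented_group S R =
     \<lparr>carrier = words S // pres_rel S R,
      monoid.mult = (\<lambda>X Y. \<Union>x\<in>X. \<Union>y\<in>Y. pres_rel S R `` {x @ y}),
      one = pres_rel S R `` {[]}\<rparr>"

lemma words_append [simp]: "u @ w \<in> words S \<longleftrightarrow> u \<in> words S \<and> w \<in> words S"
  by (auto simp: words_def)

lemma words_Nil [simp]: "[] \<in> words S"
  by (auto simp: words_def)

lemma words_Cons [simp]: "a # w \<in> words S \<longleftrightarrow> fst a \<in> S \<and> w \<in> words S"
  by (cases a) (auto simp: words_def)

lemma pres_eq_words: "pres_eq S R u w \<Longrightarrow> u \<in> words S \<and> w \<in> words S"
  by (induction rule: pres_eq.induct) auto

lemma pres_rel_iff: "(u, w) \<in> pres_rel S R \<longleftrightarrow> pres_eq S R u w"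
  by (simp add: pres_rel_def)

lemma equiv_pres_rel: "equiv (words S) (pres_rel S R)"
proof (rule equivI)
  show "pres_rel S R \<subseteq> words S \<times> words S"
    by (clarsimp simp: pres_rel_iff dest!: pres_eq_words)
  show "refl_on (words S) (pres_rel S R)"
    by (simp add: refl_on_def pres_rel_iff pres_eq.refl)
  show "Relation.sym (pres_rel S R)"
    by (rule symI, unfold pres_rel_iff) (erule pres_eq.sym)
  show "Relation.trans (pres_rel S R)"
    by (rule transI, unfold pres_rel_iff) (erule pres_eq.trans)
qed

lemma pres_eq_context:
  assumes "pres_eq S R u w" "a \<in> words S" "b \<in> words S"
  shows "pres_eq S R (a @ u @ b) (a @ w @ b)"
  using assms
proof (induction rule: pres_eq.induct)
  case (refl w)
  then show ?case by (simp add: pres_eq.refl)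
next
  case (sym u w)
  then have "pres_eq S R (a @ u @ b) (a @ w @ b)" by simp
  then show ?case by (rule pres_eq.sym)
next
  case (trans u v w)
  then have "pres_eq S R (a @ u @ b) (a @ v @ b)" "pres_eq S R (a @ v @ b) (a @ w @ b)" by simp_all
  then show ?case by (rule pres_eq.trans)
next
  case (cancel u w x c)
  then show ?case using pres_eq.cancel[of "a @ u" S "w @ b" x R c] by simp
next
  case (relator u w r)
  then show ?case using pres_eq.relator[of "a @ u" S "w @ b" r R] by simp
qed

lemma pres_eq_append:
  assumes "pres_eq S R u u'" "pres_eq S R w w'"
  shows "pres_eq S R (u @ w) (u' @ w')"
proof -
  have "pres_eq S R (u @ w) (u' @ w)"
    using pres_eq_context[OF assms(1), of "[]" w] pres_eq_words[OF assms(2)] by simp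
  moreover have "pres_eq S R (u' @ w) (u' @ w')"
    using pres_eq_context[OF assms(2), of u' "[]"] pres_eq_words[OF assms(1)] by simp
  ultimately show ?thesis by (rule pres_eq.trans)
qed

lemma UN2_const:
  assumes "\<And>x y. x \<in> A \<Longrightarrow> y \<in> B \<Longrightarrow> f x y = C" and "u \<in> A" "w \<in> B"
  shows "(\<Union>x\<in>A. \<Union>y\<in>B. f x y) = C"
proof -
  have "(\<Union>x\<in>A. \<Union>y\<in>B. f x y) = (\<Union>x\<in>A. \<Union>y\<in>B. C)"
    by (simp add: assms(1) cong: SUP_cong)
  also have "\<dots> = C" using assms(2,3) by auto
  finally show ?thesis .
qed

lemma presented_group_mult_class:
  assumes "u \<in> words S" "w \<in> words S"
  shows "(pres_rel S R `` {u}) \<otimes>\<^bsub>presented_group S R\<^esub> (pres_rel S R `` {w}) = pres_rel S R `` {u @ w}"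
proof -
  have "pres_rel S R `` {x @ y} = pres_rel S R `` {u @ w}"
    if "x \<in> pres_rel S R `` {u}" "y \<in> pres_rel S R `` {w}" for x y
    using that pres_eq_append[of S R u x w y]
    by (intro equiv_class_eq[OF equiv_pres_rel, symmetric]) (simp add: pres_rel_def)
  moreover have "u \<in> pres_rel S R `` {u}" "w \<in> pres_rel S R `` {w}"
    using assms by (simp_all add: pres_rel_def pres_eq.refl)
  ultimately have "(\<Union>x\<in>pres_rel S R `` {u}. \<Union>y\<in>pres_rel S R `` {w}. pres_rel S R `` {x @ y})
    = pres_rel S R `` {u @ w}"
    by (rule UN2_const)
  then show ?thesis by (simp add: presented_group_def)
qed

lemma pres_eq_inverse:
  "w \<in> words S \<Longrightarrow> pres_eq S R (map (\<lambda>(x, b). (x, \<not> b)) (rev w) @ w) []"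
proof (induction w)
  case Nil
  then show ?case by (simp add: pres_eq.refl)
next
  case (Cons a w)
  obtain x b where a: "a = (x, b)" by (cases a)
  let ?i = "map (\<lambda>(x, b). (x, \<not> b)) (rev w)"
  have "?i \<in> words S" using Cons.prems by (auto simp: words_def)
  then have "pres_eq S R (?i @ [(x, \<not> b), (x, \<not> \<not> b)] @ w) (?i @ w)"
    using Cons.prems a by (intro pres_eq.cancel) auto
  moreover have "pres_eq S R (?i @ w) []" using Cons by simp
  ultimately have "pres_eq S R (?i @ [(x, \<not> b), (x, \<not> \<not> b)] @ w) []" by (rule pres_eq.trans)
  then show ?case by (simp add: a)
qed

lemma group_presented_group: "group (presented_group S R)"
proof (rule groupI)
  let ?G = "presented_group S R"
  have carr: "\<exists>w\<in>words S. X = pres_rel S R `` {w}" if "X \<in> carrier ?G" for X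
    using that by (auto simp: presented_group_def elim: quotientE)
  have cl: "pres_rel S R `` {w} \<in> carrier ?G" if "w \<in> words S" for w
    using that by (auto simp: presented_group_def intro: quotientI)
  have one: "\<one>\<^bsub>?G\<^esub> = pres_rel S R `` {[]}" by (simp add: presented_group_def)
  show "\<one>\<^bsub>?G\<^esub> \<in> carrier ?G" by (simp add: one cl)
  show "X \<otimes>\<^bsub>?G\<^esub> Y \<in> carrier ?G" if "X \<in> carrier ?G" "Y \<in> carrier ?G" for X Y
    using carr[OF that(1)] carr[OF that(2)] by (auto simp: presented_group_mult_class intro!: cl)
  show "X \<otimes>\<^bsub>?G\<^esub> Y \<otimes>\<^bsub>?G\<^esub> Z = X \<otimes>\<^bsub>?G\<^esub> (Y \<otimes>\<^bsub>?G\<^esub> Z)"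
    if "X \<in> carrier ?G" "Y \<in> carrier ?G" "Z \<in> carrier ?G" for X Y Z
    using carr[OF that(1)] carr[OF that(2)] carr[OF that(3)]
    by (auto simp: presented_group_mult_class)
  show "\<one>\<^bsub>?G\<^esub> \<otimes>\<^bsub>?G\<^esub> X = X" if "X \<in> carrier ?G" for X
    using carr[OF that] by (auto simp: presented_group_mult_class one)
  show "\<exists>Y\<in>carrier ?G. Y \<otimes>\<^bsub>?G\<^esub> X = \<one>\<^bsub>?G\<^esub>" if X: "X \<in> carrier ?G" for X
  proof -
    obtain w where w: "w \<in> words S" "X = pres_rel S R `` {w}" using carr[OF X] by blast
    let ?i = "map (\<lambda>(x, b). (x, \<not> b)) (rev w)"
    have i: "?i \<in> words S" using w by (auto simp: words_def)
    have "pres_rel S R `` {?i @ w} = pres_rel S R `` {[]}"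
      using pres_eq_inverse[OF w(1)]
      by (intro equiv_class_eq[OF equiv_pres_rel]) (simp add: pres_rel_def)
    then have "(pres_rel S R `` {?i}) \<otimes>\<^bsub>?G\<^esub> X = \<one>\<^bsub>?G\<^esub>"
      by (simp only: presented_group_mult_class[OF i w(1)] w(2) one)
    then show ?thesis using cl[OF i] by blast
  qed
qed


section \<open>Right-angled Artin groups\<close>

definition raag_relators :: "'v pair_pre_digraph \<Rightarrow> 'v word set" where
  "raag_relators \<Gamma> = {[(u, True), (v, True), (u, False), (v, False)] | u v. (u, v) \<in> parcs \<Gamma>}"

definition raag :: "'v pair_pre_digraph \<Rightarrow> 'v word set monoid" where
  "raag \<Gamma> = presented_group (pverts \<Gamma>) (raag_relators \<Gamma>)"

definition raag_gen :: "'v pair_pre_digraph \<Rightarrow> 'v \<Rightarrow> 'v word set" where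
  "raag_gen \<Gamma> v = pres_rel (pverts \<Gamma>) (raag_relators \<Gamma>) `` {[(v, True)]}"

text \<open>\<open>raag_subgroup \<Gamma> \<Lambda>\<close> is \<open>A(\<Lambda>)\<close> as a subgroup of \<open>A(\<Gamma>)\<close>.\<close>

definition raag_subgroup :: "'v pair_pre_digraph \<Rightarrow> 'v pair_pre_digraph \<Rightarrow> 'v word set set" where
  "raag_subgroup \<Gamma> \<Lambda> = generate (raag \<Gamma>) (raag_gen \<Gamma> ` pverts \<Lambda>)"

text \<open>Undirected graphs are symmetric digraphs, so strongly connected components are connected
  components. The empty graph has none, so it is neither \<^const>\<open>connected\<close> nor disconnected;
  hence disconnectedness is expressed by counting components.\<close>

definition disconnected :: "('a, 'b) pre_digraph \<Rightarrow> bool" where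
  "disconnected G \<longleftrightarrow> 2 \<le> card (pre_digraph.sccs G)"

definition separating_subgraph :: "'v pair_pre_digraph \<Rightarrow> 'v pair_pre_digraph \<Rightarrow> bool" where
  "separating_subgraph \<Lambda> \<Gamma> \<longleftrightarrow>
     induced_subgraph (with_proj \<Lambda>) (with_proj \<Gamma>) \<and>
     disconnected (with_proj \<Gamma> \<restriction> (pverts \<Gamma> - pverts \<Lambda>))"


section \<open>Actions on trees\<close>

text \<open>The constant \<^const>\<open>tree\<close> is not suitable here: in a symmetric digraph every edge
  \<open>u, v\<close> yields the directed cycle \<open>u, v, u\<close>. Cycles of an undirected simple graph are the
  directed cycles of length at least 3.\<close>

locale simplicial_tree = pair_bidirected_digraph T
  for T :: "'t pair_pre_digraph" +
  assumes tree_connected: "connected (with_proj T)"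
    and tree_acyclic: "\<nexists>p. pre_digraph.cycle (with_proj T) p \<and> 3 \<le> length p"

text \<open>A splitting of \<open>G\<close> is given by its Bass--Serre tree \<open>T\<close> with the action \<open>\<rho>\<close> of \<open>G\<close>
  by automorphisms without inversions.\<close>

locale splitting = simplicial_tree T + group_action G "pverts T" \<rho>
  for G :: "('g, 'm) monoid_scheme" and T :: "'t pair_pre_digraph" and \<rho> :: "'g \<Rightarrow> 't \<Rightarrow> 't" +
  assumes edge_preserving:
      "\<And>g u v. g \<in> carrier G \<Longrightarrow> (u, v) \<in> parcs T \<Longrightarrow> (\<rho> g u, \<rho> g v) \<in> parcs T"
    and no_inversions:
      "\<And>g u v. g \<in> carrier G \<Longrightarrow> (u, v) \<in> parcs T \<Longrightarrow> \<not> (\<rho> g u = v \<and> \<rho> g v = u)"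

definition edge_stabilizer ::
    "('g, 'm) monoid_scheme \<Rightarrow> ('g \<Rightarrow> 't \<Rightarrow> 't) \<Rightarrow> 't \<times> 't \<Rightarrow> 'g set" where
  "edge_stabilizer G \<rho> e = {g \<in> carrier G. {\<rho> g (fst e), \<rho> g (snd e)} = {fst e, snd e}}"

text \<open>Points of the geometric realization, in barycentric coordinates: the support is a vertex
  or an edge.\<close>

definition tree_points :: "'t pair_pre_digraph \<Rightarrow> ('t \<Rightarrow> real) set" where
  "tree_points T =
     {p. (\<forall>v. 0 \<le> p v) \<and>
         ((\<exists>v\<in>pverts T. {x. p x \<noteq> 0} = {v}) \<or> (\<exists>(u, v)\<in>parcs T. {x. p x \<noteq> 0} = {u, v})) \<and>
         (\<Sum>x | p x \<noteq> 0. p x) = 1}"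

text \<open>The induced action on points satisfies \<open>(g \<cdot> p) (\<rho> g v) = p v\<close>.\<close>

definition fixes_point :: "('g \<Rightarrow> 't \<Rightarrow> 't) \<Rightarrow> 't pair_pre_digraph \<Rightarrow> 'g \<Rightarrow> ('t \<Rightarrow> real) \<Rightarrow> bool" where
  "fixes_point \<rho> T g p \<longleftrightarrow> (\<forall>v\<in>pverts T. p (\<rho> g v) = p v)"

definition nontrivial_splitting ::
    "('g, 'm) monoid_scheme \<Rightarrow> 't pair_pre_digraph \<Rightarrow> ('g \<Rightarrow> 't \<Rightarrow> 't) \<Rightarrow> bool" where
  "nontrivial_splitting G T \<rho> \<longleftrightarrow>
     splitting G T \<rho> \<and> \<not> (\<exists>p\<in>tree_points T. \<forall>g\<in>carrier G. fixes_point \<rho> T g p)"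

definition splitting_over ::
    "('g, 'm) monoid_scheme \<Rightarrow> 'g set set \<Rightarrow> 't pair_pre_digraph \<Rightarrow> ('g \<Rightarrow> 't \<Rightarrow> 't) \<Rightarrow> bool" where
  "splitting_over G \<A> T \<rho> \<longleftrightarrow> splitting G T \<rho> \<and> (\<forall>e\<in>parcs T. edge_stabilizer G \<rho> e \<in> \<A>)"

definition subgroup_family :: "('g, 'm) monoid_scheme \<Rightarrow> 'g set set \<Rightarrow> bool" where
  "subgroup_family G \<A> \<longleftrightarrow> (\<forall>H\<in>\<A>. subgroup H G)"

definition closed_under_subgroups :: "('g, 'm) monoid_scheme \<Rightarrow> 'g set set \<Rightarrow> bool" where
  "closed_under_subgroups G \<A> \<longleftrightarrow> (\<forall>H\<in>\<A>. \<forall>K. subgroup K G \<and> K \<subseteq> H \<longrightarrow> K \<in> \<A>)"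

end

theory Submission
  imports Defs
begin

text \<open>The argument distinguishes how the standard generators act on the Bass--Serre tree \<open>T\<close>.

  Suppose some generator \<open>s\<close> fixes no vertex. As there are no inversions, it translates a line \<open>L\<close>
  of \<open>T\<close> nontrivially (\<open>axis_exists\<close>), and such a line is unique up to a shift (\<open>axis_unique\<close>). Hence
  every element commuting with \<open>s\<close> translates \<open>L\<close> too, possibly by zero (\<open>commuting_translates\<close>).
  Let \<open>\<Lambda>\<close> be spanned by the generators that fix \<open>L\<close> pointwise. If all generators
  translate \<open>L\<close>, then so does the whole group, and the translation length is a homomorphism to the
  integers whose kernel fixes \<open>L\<close> pointwise. Otherwise no edge joins a generator translating \<open>L\<close>
  nontrivially to one that does not translate \<open>L\<close>, so \<open>\<Lambda>\<close> separates, and \<open>A(\<Lambda>)\<close> fixes \<open>L\<close>.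

  Suppose each generator fixes a vertex. Their fixed sets are subtrees, and those of adjacent
  generators meet (\<open>commuting_fixed_sets\<close>). The action being nontrivial, there is no common fixed
  vertex, so two of the fixed subtrees lie on different sides of some edge \<open>e\<close>
  (\<open>separating_edge\<close>). Let \<open>\<Lambda>\<close> be spanned by the generators fixing \<open>e\<close>. The fixed subtree of any
  other generator lies on one side of \<open>e\<close>, the same one for adjacent generators. So \<open>\<Lambda>\<close> separates, and
  \<open>A(\<Lambda>)\<close> fixes \<open>e\<close>.

  In each case the subgroup in question is contained in an edge stabilizer, hence belongs to the
  family.

  The tree geometry rests on a single fact: a walk without backtracking has distinct vertices
  (\<open>reduced_walk_distinct\<close>). Consequently such walks are the geodesics, and half-trees, bridges between
  subtrees and axes are all treated by gluing them.\<close>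

section \<open>Reduced walks\<close>

fun reduced_walk :: "'t pair_pre_digraph \<Rightarrow> 't list \<Rightarrow> bool" where
  "reduced_walk T [] \<longleftrightarrow> False"
| "reduced_walk T [x] \<longleftrightarrow> x \<in> pverts T"
| "reduced_walk T [x, y] \<longleftrightarrow> (x, y) \<in> parcs T"
| "reduced_walk T (x # y # z # xs) \<longleftrightarrow> (x, y) \<in> parcs T \<and> x \<noteq> z \<and> reduced_walk T (y # z # xs)"

lemma reduced_walk_hd_arc: "reduced_walk T (x # y # ys) \<Longrightarrow> (x, y) \<in> parcs T"
  by (cases ys) auto

lemma reduced_walk_append:
  "reduced_walk T (xs @ x # y # ys) \<longleftrightarrow> reduced_walk T (xs @ [x, y]) \<and> reduced_walk T (x # y # ys)"
proof (induction xs rule: induct_list012)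
  case 1
  then show ?case by (auto dest: reduced_walk_hd_arc)
next
  case (2 a)
  then show ?case by (auto dest: reduced_walk_hd_arc)
next
  case (3 a b zs)
  then show ?case by (cases zs) auto
qed

lemma reduced_walk_nth_arc:
  "reduced_walk T xs \<Longrightarrow> Suc k < length xs \<Longrightarrow> (xs ! k, xs ! Suc k) \<in> parcs T"
proof (induction xs arbitrary: k rule: induct_list012)
  case (3 x y zs)
  then show ?case by (cases k; cases zs) auto
qed auto

lemma reduced_walk_map:
  assumes "reduced_walk T xs" "set xs \<subseteq> A" "inj_on f A"
    and "\<And>x. x \<in> pverts T \<Longrightarrow> f x \<in> pverts T"
    and "\<And>x y. (x, y) \<in> parcs T \<Longrightarrow> (f x, f y) \<in> parcs T"
  shows "reduced_walk T (map f xs)"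
  using assms by (induction T xs rule: reduced_walk.induct) (auto simp: inj_on_def)

context simplicial_tree
begin

lemma reduced_walk_verts: "reduced_walk T xs \<Longrightarrow> set xs \<subseteq> pverts T"
proof (induction xs rule: induct_list012)
  case (3 x y zs)
  then show ?case by (cases zs) (auto intro: in_arcsD1 in_arcsD2)
qed simp_all

lemma reduced_walk_tl: "reduced_walk T (x # y # ys) \<Longrightarrow> reduced_walk T (y # ys)"
  by (cases ys) (auto intro: in_arcsD2)

lemma reduced_walk_prefix: "reduced_walk T (xs @ ys) \<Longrightarrow> xs \<noteq> [] \<Longrightarrow> reduced_walk T xs"
proof (induction xs rule: induct_list012)
  case (2 x)
  then show ?case using reduced_walk_verts by fastforce
next
  case (3 x y zs)
  then show ?case
    by (cases zs; cases ys) (auto dest: reduced_walk_hd_arc)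
qed simp

lemma reduced_walk_rev: "reduced_walk T (rev xs) \<longleftrightarrow> reduced_walk T xs"
proof -
  have "reduced_walk T xs \<Longrightarrow> reduced_walk T (rev xs)" for xs
  proof (induction xs rule: induct_list012)
    case (3 x y zs)
    then show ?case
      using reduced_walk_append[of T "rev (tl zs)" "hd zs" y "[x]"]
      by (cases zs) (auto intro: arcs_symmetric dest: reduced_walk_hd_arc)
  qed auto
  from this[of xs] this[of "rev xs"] show ?thesis by auto
qed

lemma reduced_walk_awalk:
  assumes "reduced_walk T xs"
  shows "awalk (hd xs) (zip xs (tl xs)) (last xs) \<and> pawalk_verts (hd xs) (zip xs (tl xs)) = xs"
  using assms
proof (induction xs rule: induct_list012)
  case (3 x y zs)
  from reduced_walk_tl[OF 3(3)] 3(2) reduced_walk_hd_arc[OF 3(3)] show ?case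
    by (auto simp: awalk_Cons_iff)
qed (auto simp: awalk_Nil_iff)

text \<open>A walk without backtracking that is not distinct contains a shortest piece with equal ends.
  That piece is a cycle of length at least three, since a tree has neither loops nor, by reducedness,
  pieces of the form \<open>x, y, x\<close>.\<close>

lemma reduced_walk_distinct: "reduced_walk T xs \<Longrightarrow> distinct xs"
proof (induction xs rule: length_induct)
  case (1 xs)
  show ?case
  proof (rule ccontr)
    assume nd: "\<not> distinct xs"
    obtain x ys where xs: "xs = x # ys" using 1(2) by (cases xs) auto
    have "ys \<noteq> []" using nd xs by auto
    then obtain zs z where ys: "ys = zs @ [z]" by (metis rev_exhaust)
    have "reduced_walk T ys" using 1(2) xs \<open>ys \<noteq> []\<close> reduced_walk_tl by (cases ys) auto
    then have d1: "distinct ys" using 1(1) xs by auto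
    have "reduced_walk T (x # zs)" using reduced_walk_prefix[of "x # zs" "[z]"] 1(2) xs ys by auto
    then have d2: "distinct (x # zs)" using 1(1)[rule_format, of "x # zs"] xs ys by simp
    have z: "z = x" using d1 d2 nd xs ys by auto
    have loop: "(x, x) \<notin> parcs T" using no_loops' by blast
    have len: "2 \<le> length zs"
      using 1(2) loop unfolding xs ys z
      by (cases zs; cases "tl zs") (auto simp: Suc_le_eq)
    have "cycle (zip xs (tl xs))"
      using reduced_walk_awalk[OF 1(2)] d1 unfolding cycle_def xs
      by (intro exI[of _ x]) (auto simp: ys z)
    moreover have "3 \<le> length (zip xs (tl xs))" using len xs ys by simp
    ultimately show False using tree_acyclic by blast
  qed
qed

text \<open>If two reduced walks with the same ends leave their first vertex along different edges, then
  the reverse of the first followed by the second does not backtrack, so its vertices are distinct;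
  but it is closed. Hence the first edges agree, and induction applies.\<close>

lemma reduced_walk_unique:
  assumes "reduced_walk T xs" "reduced_walk T ys" "hd xs = hd ys" "last xs = last ys"
  shows "xs = ys"
  using assms
proof (induction xs arbitrary: ys rule: induct_list012)
  case 1
  then show ?case by simp
next
  case (2 x)
  obtain zs where "ys = x # zs" using 2 by (cases ys) auto
  moreover have "distinct ys" using 2 reduced_walk_distinct by blast
  ultimately show ?case using 2 by (cases zs) (auto split: if_splits)
next
  case (3 x y zs)
  obtain us where us: "ys = x # us" using 3 by (cases ys) auto
  have dx: "distinct (x # y # zs)" using 3 reduced_walk_distinct by blast
  have "us \<noteq> []" using 3(6) us dx by (auto split: if_splits)
  then obtain v vs where us: "ys = x # v # vs" using us by (cases us) auto
  have ry: "reduced_walk T (y # zs)" "reduced_walk T (v # vs)"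
    using 3(3,4) us reduced_walk_tl by auto
  show ?case
  proof (cases "v = y")
    case True
    then show ?thesis using 3(2)[OF ry] 3(6) us by simp
  next
    case False
    have 1: "reduced_walk T (rev zs @ [y, x])" using 3(3) reduced_walk_rev[of "x # y # zs"] by simp
    have 2: "reduced_walk T (y # x # v # vs)"
      using False 3(3,4) us by (auto dest: reduced_walk_hd_arc intro: arcs_symmetric)
    have "reduced_walk T (rev zs @ y # x # v # vs)"
      using reduced_walk_append[of T "rev zs" y x "v # vs"] 1 2 by simp
    from reduced_walk_distinct[OF this] have "set (y # zs) \<inter> set (v # vs) = {}" by auto
    moreover have "last (y # zs) \<in> set (y # zs)" "last (v # vs) \<in> set (v # vs)"
      by (metis last_in_set list.distinct(1))+
    ultimately show ?thesis using 3(6) us by auto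
  qed
qed

lemma reduced_walk_exists:
  assumes "x \<in> pverts T" "y \<in> pverts T"
  shows "\<exists>xs. reduced_walk T xs \<and> hd xs = x \<and> last xs = y"
proof -
  have "reachable (with_proj (mk_symmetric (with_proj T))) x y"
    using tree_connected assms by (auto simp: connected_def elim!: strongly_connectedE)
  then have "reachable (with_proj T) x y" using reachable_mk_symmetric_eq[OF pair_sym_arcs] by simp
  then show ?thesis
  proof (induction rule: converse_reachable_induct)
    case base
    then show ?case by (intro exI[of _ "[y]"]) simp
  next
    case (step x z)
    then obtain xs where xs: "reduced_walk T (z # xs)" "last (z # xs) = y"
      by (metis list.collapse reduced_walk.simps(1))
    show ?case
    proof (cases "xs \<noteq> [] \<and> hd xs = x")
      case True
      then show ?thesis using xs reduced_walk_tl[of z x "tl xs"] by (intro exI[of _ xs]) (cases xs; auto)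
    next
      case False
      then show ?thesis using xs step(1) by (intro exI[of _ "x # z # xs"]) (cases xs; auto)
    qed
  qed
qed

section \<open>Geodesics, half-trees and convex sets\<close>

definition geo :: "'t \<Rightarrow> 't \<Rightarrow> 't list" where
  "geo x y = (THE xs. reduced_walk T xs \<and> hd xs = x \<and> last xs = y)"

lemma geo_eqI: "reduced_walk T xs \<Longrightarrow> hd xs = x \<Longrightarrow> last xs = y \<Longrightarrow> geo x y = xs"
  unfolding geo_def by (rule the_equality) (auto intro: reduced_walk_unique)

lemma geo:
  assumes "x \<in> pverts T" "y \<in> pverts T"
  shows reduced_geo: "reduced_walk T (geo x y)"
    and hd_geo: "hd (geo x y) = x" and last_geo: "last (geo x y) = y"
proof -
  obtain xs where xs: "reduced_walk T xs" "hd xs = x" "last xs = y"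
    using reduced_walk_exists[OF assms] by blast
  from geo_eqI[OF this] xs
  show "reduced_walk T (geo x y)" "hd (geo x y) = x" "last (geo x y) = y" by simp_all
qed

lemma geo_ends:
  assumes "x \<in> pverts T" "y \<in> pverts T"
  shows geo_not_Nil: "geo x y \<noteq> []"
    and start_in_geo: "x \<in> set (geo x y)" and end_in_geo: "y \<in> set (geo x y)"
proof -
  show ne: "geo x y \<noteq> []" using reduced_geo[OF assms] by (cases "geo x y") simp_all
  show "x \<in> set (geo x y)" "y \<in> set (geo x y)"
    using hd_in_set[OF ne] last_in_set[OF ne] by (simp_all only: hd_geo[OF assms] last_geo[OF assms])
qed

lemma geo_Cons:
  assumes "x \<in> pverts T" "y \<in> pverts T"
  shows "\<exists>r. geo x y = x # r"
  using geo_not_Nil[OF assms] hd_geo[OF assms] by (cases "geo x y") simp_all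

lemma geo_Snoc:
  assumes "x \<in> pverts T" "y \<in> pverts T"
  shows "\<exists>r. geo x y = r @ [y]"
  using geo_not_Nil[OF assms] last_geo[OF assms] by (cases "geo x y" rule: rev_cases) simp_all

lemma geo_rev: "x \<in> pverts T \<Longrightarrow> y \<in> pverts T \<Longrightarrow> geo y x = rev (geo x y)"
  by (rule geo_eqI) (simp_all add: reduced_walk_rev reduced_geo hd_geo last_geo hd_rev last_rev)

text \<open>\<open>across x x' y\<close> describes the half-tree beyond the oriented edge from \<open>x\<close> to \<open>x'\<close>: the
  vertices \<open>y\<close> that are reached from \<open>x\<close> through \<open>x'\<close>.\<close>

definition across :: "'t \<Rightarrow> 't \<Rightarrow> 't \<Rightarrow> bool" where
  "across x x' y \<longleftrightarrow> (x, x') \<in> parcs T \<and> y \<in> pverts T \<and> geo x y = x # geo x' y"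

lemma across_verts:
  assumes "across x x' y"
  shows "x \<in> pverts T" "x' \<in> pverts T" "y \<in> pverts T"
  using assms in_arcsD1[of x x'] in_arcsD2[of x x'] by (simp_all add: across_def)

lemma across_geo: "across x x' y \<Longrightarrow> geo x y = x # geo x' y"
  by (simp add: across_def)

lemma across_cases:
  assumes "(x, x') \<in> parcs T" "y \<in> pverts T"
  shows "across x x' y \<or> across x' x y"
proof -
  have v: "x \<in> pverts T" "x' \<in> pverts T" using assms in_arcsD1 in_arcsD2 by auto
  obtain r where r: "geo x' y = x' # r"
    using geo_Cons[OF v(2) assms(2)] by blast
  have red: "reduced_walk T (x' # r)" "last (x' # r) = y" using geo[OF v(2) assms(2)] r by auto
  show ?thesis
  proof (cases "r \<noteq> [] \<and> hd r = x")
    case True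
    then have "geo x y = r" using red reduced_walk_tl[of x' x "tl r"] by (intro geo_eqI) (cases r; auto)+
    then show ?thesis using r assms arcs_symmetric by (auto simp: across_def)
  next
    case False
    then have "geo x y = x # x' # r" using red assms by (intro geo_eqI) (cases r; auto)+
    then show ?thesis using r assms by (auto simp: across_def)
  qed
qed

text \<open>Two reduced walks that share an edge may be glued along it, because reducedness only concerns
  three consecutive vertices. So the geodesic between the two half-trees of an edge crosses that edge.\<close>

lemma across_concat:
  assumes "across x' x u" "across x x' v"
  shows "geo u v = geo u x @ geo x' v"
proof -
  have v: "x \<in> pverts T" "x' \<in> pverts T" "u \<in> pverts T" "v \<in> pverts T"
    using across_verts[OF assms(1)] across_verts[OF assms(2)] by simp_all
  obtain as where as: "geo u x = as @ [x]"
    using geo_Snoc[OF v(3,1)] by blast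
  obtain bs where bs: "geo x' v = x' # bs"
    using geo_Cons[OF v(2,4)] by blast
  have "geo u x' = as @ [x, x']"
  proof -
    have "geo x' u = x' # geo x u" using assms(1) by (rule across_geo)
    then have "geo u x' = geo u x @ [x']" using geo_rev[OF v(2,3)] geo_rev[OF v(1,3)] by simp
    then show ?thesis using as by simp
  qed
  then have "reduced_walk T (as @ [x, x'])" using reduced_geo[OF v(3,2)] by simp
  moreover have "reduced_walk T (x # x' # bs)"
    using across_geo[OF assms(2)] bs reduced_geo[OF v(1,4)] by simp
  ultimately have "reduced_walk T (as @ x # x' # bs)" using reduced_walk_append[of T as x x' bs] by simp
  moreover have "hd (as @ x # x' # bs) = u" using hd_geo[OF v(3,1)] as by (cases as) auto
  moreover have "last (as @ x # x' # bs) = v" using last_geo[OF v(2,4)] bs by auto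
  ultimately show ?thesis using as bs geo_eqI by simp
qed

definition convex :: "'t set \<Rightarrow> bool" where
  "convex K \<longleftrightarrow> K \<subseteq> pverts T \<and> (\<forall>x\<in>K. \<forall>y\<in>K. set (geo x y) \<subseteq> K)"

text \<open>Take \<open>x\<close> in \<open>K\<close> and \<open>y\<close> in \<open>F\<close> at minimal distance and let \<open>x'\<close> be the second vertex of the
  geodesic from \<open>x\<close> to \<open>y\<close>. By minimality \<open>x'\<close> lies outside \<open>K\<close>, so no geodesic inside \<open>K\<close> crosses
  the edge; and a geodesic inside \<open>F\<close> that crossed it would put \<open>x\<close> into \<open>F\<close>.\<close>

lemma bridge:
  assumes "convex K" "convex F" "K \<noteq> {}" "F \<noteq> {}" "K \<inter> F = {}"
  obtains x x' where "(x, x') \<in> parcs T" "x \<in> K" "x' \<notin> K"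
    "\<And>z. z \<in> K \<Longrightarrow> across x' x z" "\<And>z. z \<in> F \<Longrightarrow> across x x' z"
proof -
  have KV: "K \<subseteq> pverts T" and FV: "F \<subseteq> pverts T" using assms by (auto simp: convex_def)
  obtain k f where "k \<in> K" "f \<in> F" using assms(3,4) by blast
  then have "(k, f) \<in> K \<times> F" by simp
  from ex_has_least_nat[of "\<lambda>p. p \<in> K \<times> F", OF this, of "\<lambda>p. length (geo (fst p) (snd p))"]
  obtain p where p: "p \<in> K \<times> F"
    "\<forall>q. q \<in> K \<times> F \<longrightarrow> length (geo (fst p) (snd p)) \<le> length (geo (fst q) (snd q))"
    by blast
  obtain x y where "p = (x, y)" by (cases p)
  with p have xy: "x \<in> K" "y \<in> F"
    and min: "\<And>a b. a \<in> K \<Longrightarrow> b \<in> F \<Longrightarrow> length (geo x y) \<le> length (geo a b)"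
    by auto
  have v: "x \<in> pverts T" "y \<in> pverts T" using xy KV FV by auto
  have "x \<noteq> y" using xy assms(5) by blast
  obtain r0 where r0: "geo x y = x # r0"
    using geo_Cons[OF v] by blast
  have "r0 \<noteq> []" using last_geo[OF v] r0 \<open>x \<noteq> y\<close> by auto
  then obtain x' r where r: "geo x y = x # x' # r" using r0 by (cases r0) simp_all
  have red: "reduced_walk T (x # x' # r)" using reduced_geo[OF v] r by simp
  have e: "(x, x') \<in> parcs T" using red by (rule reduced_walk_hd_arc)
  have "geo x' y = x' # r" using reduced_walk_tl[OF red] last_geo[OF v] r by (intro geo_eqI) auto
  then have y: "across x x' y" and len: "length (geo x' y) < length (geo x y)"
    using r e v by (auto simp: across_def)
  have x': "x' \<notin> K" using min[of x' y] len xy(2) by (meson leD)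
  have K: "across x' x z" if z: "z \<in> K" for z
  proof (rule ccontr)
    assume "\<not> across x' x z"
    then have "across x x' z" using across_cases[OF e] z KV by blast
    then have "x' \<in> set (geo x z)"
      using start_in_geo[of x' z] across_verts[of x x' z] across_geo[of x x' z] by simp
    then show False using assms(1) xy z x' by (auto simp: convex_def)
  qed
  have F: "across x x' z" if z: "z \<in> F" for z
  proof (rule ccontr)
    assume "\<not> across x x' z"
    then have "across x' x z" using across_cases[OF e] z FV by blast
    from across_concat[OF y this] have "x \<in> set (geo y z)"
      using start_in_geo[of x z] v z FV by auto
    moreover have "set (geo y z) \<subseteq> F" using assms(2) xy z by (auto simp: convex_def)
    ultimately show False using assms(5) xy by blast
  qed
  show thesis using that[OF e xy(1) x' K F] .
qed

section \<open>Automorphisms and fixed vertices\<close>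

text \<open>Arcs are then also reflected: the image of the tree is a connected spanning subgraph of the
  tree, hence all of it.\<close>

definition automorphism :: "('t \<Rightarrow> 't) \<Rightarrow> bool" where
  "automorphism f \<longleftrightarrow> bij_betw f (pverts T) (pverts T) \<and> (\<forall>x y. (x, y) \<in> parcs T \<longrightarrow> (f x, f y) \<in> parcs T)"

lemma automorphism_vert: "automorphism f \<Longrightarrow> x \<in> pverts T \<Longrightarrow> f x \<in> pverts T"
  unfolding automorphism_def by (blast dest: bij_betwE)

lemma automorphism_arc: "automorphism f \<Longrightarrow> (x, y) \<in> parcs T \<Longrightarrow> (f x, f y) \<in> parcs T"
  by (simp add: automorphism_def)

lemma automorphism_inj_on: "automorphism f \<Longrightarrow> inj_on f (pverts T)"
  by (simp add: automorphism_def bij_betw_def)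

lemma automorphism_inj:
  "automorphism f \<Longrightarrow> f x = f y \<Longrightarrow> x \<in> pverts T \<Longrightarrow> y \<in> pverts T \<Longrightarrow> x = y"
  by (rule inj_onD[OF automorphism_inj_on])

lemma geo_automorphism:
  assumes f: "automorphism f" and v: "x \<in> pverts T" "y \<in> pverts T"
  shows "geo (f x) (f y) = map f (geo x y)"
proof (rule geo_eqI)
  show "reduced_walk T (map f (geo x y))"
    by (intro reduced_walk_map[OF reduced_geo[OF v] reduced_walk_verts[OF reduced_geo[OF v]]]
      automorphism_inj_on[OF f] automorphism_vert[OF f] automorphism_arc[OF f])
qed (use geo[OF v] geo_not_Nil[OF v] in \<open>auto simp: hd_map last_map\<close>)

lemma across_automorphism:
  assumes "automorphism f" "across x x' y"
  shows "across (f x) (f x') (f y)"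
  using assms across_verts[OF assms(2)]
    geo_automorphism[OF assms(1), of x y] geo_automorphism[OF assms(1), of x' y]
  by (simp add: across_def automorphism_vert automorphism_arc)

lemma convex_fixed_set:
  assumes f: "automorphism f"
  shows "convex {x \<in> pverts T. f x = x}"
proof -
  have "set (geo x y) \<subseteq> {x \<in> pverts T. f x = x}"
    if v: "x \<in> pverts T" "y \<in> pverts T" and "f x = x" "f y = y" for x y
  proof -
    have "map f (geo x y) = geo x y" using geo_automorphism[OF f v, symmetric] unfolding that(3,4) .
    then have "f z = z" if "z \<in> set (geo x y)" for z
      using that map_eq_conv[of f "geo x y" id] by simp
    then show ?thesis using reduced_walk_verts[OF reduced_geo[OF v]] by blast
  qed
  then show ?thesis by (auto simp: convex_def)
qed

text \<open>If the two fixed sets were disjoint, an edge with end \<open>x\<close> in the first one would lead from it to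
  the second one. Since \<open>f\<close> preserves the second set and fixes \<open>x\<close>, the image of this edge leads there
  as well, so \<open>f\<close> fixes its other end, which was chosen outside the fixed set.\<close>

lemma commuting_fixed_sets:
  assumes f: "automorphism f" and g: "automorphism g"
    and comm: "\<And>x. x \<in> pverts T \<Longrightarrow> f (g x) = g (f x)"
    and "a \<in> pverts T" "f a = a" and b: "b \<in> pverts T" "g b = b"
  shows "\<exists>x\<in>pverts T. f x = x \<and> g x = x"
proof (rule ccontr)
  let ?K = "{x \<in> pverts T. f x = x}" and ?F = "{x \<in> pverts T. g x = x}"
  assume "\<not> ?thesis"
  then have disj: "?K \<inter> ?F = {}" and ne: "?K \<noteq> {}" "?F \<noteq> {}" using assms(4-) by blast+
  obtain x x' where x: "(x, x') \<in> parcs T" "x \<in> ?K" "x' \<notin> ?K"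
    and "\<And>z. z \<in> ?K \<Longrightarrow> across x' x z" and F: "\<And>z. z \<in> ?F \<Longrightarrow> across x x' z"
    by (rule bridge[OF convex_fixed_set[OF f] convex_fixed_set[OF g] ne disj]) (rule that)
  have x'V: "x' \<in> pverts T" using in_arcsD2 x(1) by blast
  have "f b \<in> ?F" using comm[OF b(1)] b automorphism_vert[OF f] by auto
  then have 1: "across x x' (f b)" using F by blast
  have 2: "across x (f x') (f b)"
    using across_automorphism[OF f F[of b]] b x(2) by auto
  have "hd (geo x' (f b)) = x'" "hd (geo (f x') (f b)) = f x'"
    using hd_geo b automorphism_vert[OF f] x'V by simp_all
  moreover have "geo x' (f b) = geo (f x') (f b)" using across_geo[OF 1] across_geo[OF 2] by simp
  ultimately have "f x' = x'" by metis
  then show False using x(3) x'V by auto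
qed

lemma convex_Inter:
  assumes "I \<noteq> {}" "\<And>i. i \<in> I \<Longrightarrow> convex (F i)"
  shows "convex (\<Inter>i\<in>I. F i)"
proof -
  obtain j where "j \<in> I" using assms(1) by blast
  then have V: "(\<Inter>i\<in>I. F i) \<subseteq> pverts T" using assms(2)[of j] by (auto simp: convex_def)
  have "set (geo x y) \<subseteq> F i" if "x \<in> (\<Inter>i\<in>I. F i)" "y \<in> (\<Inter>i\<in>I. F i)" "i \<in> I" for x y i
    using assms(2)[OF that(3)] that by (auto simp: convex_def)
  then show ?thesis unfolding convex_def by (intro conjI V ballI INT_greatest)
qed

text \<open>The contrapositive of the Helly property of subtrees, with disjointness of two members
  witnessed by an edge. In the induction step, if the old members have a common vertex, then the
  bridge from the nonempty intersection of the old members to the new one ends outside some old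
  member, and that old member is the one on the near side.\<close>

lemma separating_edge:
  assumes "finite I" "I \<noteq> {}" "\<And>i. i \<in> I \<Longrightarrow> convex (F i)" "\<And>i. i \<in> I \<Longrightarrow> F i \<noteq> {}"
    and "(\<Inter>i\<in>I. F i) = {}"
  shows "\<exists>x x' i j. (x, x') \<in> parcs T \<and> i \<in> I \<and> j \<in> I
    \<and> (\<forall>z\<in>F i. across x' x z) \<and> (\<forall>z\<in>F j. across x x' z)"
  using assms
proof (induction I rule: finite_ne_induct)
  case (singleton i)
  then show ?case by simp
next
  case (insert j I)
  show ?case
  proof (cases "(\<Inter>i\<in>I. F i) = {}")
    case True
    have "convex (F i)" "F i \<noteq> {}" if "i \<in> I" for i using insert.prems(1,2)[of i] that by simp_all
    from insert.IH[OF this True] show ?thesis by blast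
  next
    case False
    let ?K = "\<Inter>i\<in>I. F i"
    have K: "convex ?K" using insert.hyps(2) insert.prems(1) by (intro convex_Inter) simp_all
    have disj: "?K \<inter> F j = {}" using insert.prems(3) by auto
    have Fj: "convex (F j)" "F j \<noteq> {}" using insert.prems(1,2)[of j] by simp_all
    obtain x x' where x: "(x, x') \<in> parcs T" "x \<in> ?K" "x' \<notin> ?K"
      and "\<And>z. z \<in> ?K \<Longrightarrow> across x' x z" and F: "\<And>z. z \<in> F j \<Longrightarrow> across x x' z"
      by (rule bridge[OF K Fj(1) False Fj(2) disj]) (rule that)
    obtain i where i: "i \<in> I" "x' \<notin> F i" using x by blast
    have Fi: "convex (F i)" "x \<in> F i" using i x(2) insert.prems(1)[of i] by simp_all
    have "across x' x z" if z: "z \<in> F i" for z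
    proof (rule ccontr)
      assume "\<not> across x' x z"
      then have "across x x' z" using across_cases[OF x(1)] z Fi by (auto simp: convex_def)
      then have "x' \<in> set (geo x z)"
        using start_in_geo[of x' z] across_verts[of x x' z] across_geo[of x x' z] by simp
      then show False using Fi z i by (auto simp: convex_def)
    qed
    then show ?thesis using x(1) i(1) F by blast
  qed
qed

section \<open>Lines and translations\<close>

definition line :: "(int \<Rightarrow> 't) \<Rightarrow> bool" where
  "line L \<longleftrightarrow> (\<forall>i. (L i, L (i + 1)) \<in> parcs T \<and> L i \<noteq> L (i + 2))"

lemma line_vert: "line L \<Longrightarrow> L i \<in> pverts T"
  using in_arcsD1 by (auto simp: line_def)

lemma reduced_walk_line: "line L \<Longrightarrow> reduced_walk T (map L [i..i + int n])"
proof (induction n arbitrary: i rule: induct_nat_012)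
  case 0
  then show ?case using line_vert by simp
next
  case 1
  then show ?case by (auto simp: upto_rec1 line_def)
next
  case (ge2 n)
  have "[i..i + int (Suc (Suc n))] = i # (i + 1) # (i + 2) # [i + 3..i + int n + 2]"
    and "[i + 1..(i + 1) + int (Suc n)] = (i + 1) # (i + 2) # [i + 3..i + int n + 2]"
    by (simp_all add: upto_rec1 algebra_simps)
  then show ?case using ge2(2)[of "i + 1"] ge2(3) by (simp add: line_def)
qed

lemma geo_line:
  assumes "line L" "i \<le> j"
  shows "geo (L i) (L j) = map L [i..j]"
proof (rule geo_eqI)
  show "reduced_walk T (map L [i..j])"
    using reduced_walk_line[OF assms(1), of i "nat (j - i)"] assms(2) by simp
  show "hd (map L [i..j]) = L i" using assms(2) by (simp add: upto_rec1[of i j])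
  show "last (map L [i..j]) = L j" using assms(2) by (simp add: upto_rec2[of i j])
qed

lemma line_inj:
  assumes L: "line L" and eq: "L i = L j"
  shows "i = j"
proof -
  have "i = j" if "i \<le> j" "L i = L j" for i j
    using reduced_walk_distinct[OF reduced_walk_line[OF L, of i "nat (j - i)"]] that
    by (auto simp: distinct_map inj_on_def)
  from this[of i j] this[of j i] eq show ?thesis by (metis linear)
qed

lemma convex_line: 
  assumes L: "line L"
  shows "convex (range L)"
proof -
  have "set (geo (L i) (L j)) \<subseteq> range L" for i j
    using geo_line[OF L, of i j] geo_line[OF L, of j i] geo_rev[OF line_vert[OF L] line_vert[OF L], of i j]
    by (cases "i \<le> j") auto
  then show ?thesis using line_vert[OF L] by (auto simp: convex_def)
qed

definition translates :: "('t \<Rightarrow> 't) \<Rightarrow> (int \<Rightarrow> 't) \<Rightarrow> int \<Rightarrow> bool" where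
  "translates f L k \<longleftrightarrow> (\<forall>i. f (L i) = L (i + k))"

text \<open>Suppose \<open>M 0\<close> is off \<open>L\<close>, and let the edge from \<open>x\<close> to \<open>x'\<close> be the bridge from \<open>L\<close> to it.
  The geodesic from \<open>M 0\<close> to its image runs down this bridge, along \<open>L\<close> from \<open>x\<close> to \<open>f x\<close>, and up the
  translated bridge. It is therefore longer than the stretch of \<open>M\<close> of length \<open>l\<close> with the same ends.\<close>

lemma axis_meets:
  assumes f: "automorphism f" and L: "line L" and M: "line M"
    and tL: "translates f L l" and tM: "translates f M l" and l: "0 < l"
  shows "M 0 \<in> range L"
proof (rule ccontr)
  assume "M 0 \<notin> range L"
  then have disj: "range L \<inter> {M 0} = {}" by auto
  have F: "convex {M 0}"
    using line_vert[OF M] geo_eqI[of "[M 0]" "M 0" "M 0"] by (auto simp: convex_def)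
  obtain x x' where x: "(x, x') \<in> parcs T" "x \<in> range L" "x' \<notin> range L"
      and K: "\<And>z. z \<in> range L \<Longrightarrow> across x' x z"
      and M0': "\<And>z. z \<in> {M 0} \<Longrightarrow> across x x' z"
    by (rule bridge[OF convex_line[OF L] F _ _ disj]) (auto intro: that)
  have M0: "across x x' (M 0)" using M0' by simp
  obtain i where i: "x = L i" using x by auto
  have fx: "f x = L (i + l)" "f (M 0) = M l" "f (L (i - l)) = x"
    using tL tM i by (auto simp: translates_def)
  have 1: "across (f x) (f x') (M l)" using across_automorphism[OF f M0] fx by simp
  have "across (f x') (f x) x" using across_automorphism[OF f K[of "L (i - l)"]] fx by simp
  from across_concat[OF this 1]
  have geo1: "geo x (M l) = map L [i..i + l] @ geo (f x') (M l)"
    using geo_line[OF L, of i "i + l"] fx i l by simp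
  have "\<not> across x x' (M l)"
  proof
    assume a: "across x x' (M l)"
    have "hd (tl (geo x (M l))) = L (i + 1)"
      using l unfolding geo1 by (simp add: upto_rec1[of i] upto_rec1[of "i + 1"])
    moreover have "hd (tl (geo x (M l))) = x'"
      using across_geo[OF a] across_verts[OF a] hd_geo[of x' "M l"] by simp
    ultimately show False using x(3) by auto
  qed
  then have "across x' x (M l)" using across_cases[OF x(1)] line_vert[OF M] by blast
  from across_concat[OF M0 this] geo1
  have "geo (M 0) (M l) = geo (M 0) x' @ map L [i..i + l] @ geo (f x') (M l)" by simp
  moreover have "geo (M 0) (M l) = map M [0..l]" using geo_line[OF M] l by simp
  ultimately have "length (map M [0..l]) = length (geo (M 0) x' @ map L [i..i + l] @ geo (f x') (M l))"
    by simp
  then have "geo (M 0) x' = []" using l by simp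
  then show False using geo_not_Nil[of "M 0" x'] line_vert[OF M] in_arcsD2[OF x(1)] by simp
qed

text \<open>A common vertex of \<open>L\<close> and \<open>M\<close> is moved by the powers of \<open>f\<close> arbitrarily far in both
  directions, with the same image on both lines, and geodesics are unique in between.\<close>

lemma axis_unique:
  assumes f: "automorphism f" and L: "line L" and M: "line M"
    and tL: "translates f L l" and tM: "translates f M l" and l: "0 < l"
  shows "\<exists>a. \<forall>i. M i = L (i + a)"
proof -
  obtain a where a: "M 0 = L a" using axis_meets[OF assms] by auto
  have step: "M (q * l) = L (a + q * l)" for q
  proof (induction q rule: int_induct[of _ 0])
    case base
    then show ?case using a by simp
  next
    case (step1 q)
    then have "f (M (q * l)) = f (L (a + q * l))" by simp
    then show ?case using tL tM by (simp add: translates_def algebra_simps)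
  next
    case (step2 q)
    have "f (M ((q - 1) * l)) = M (q * l)" "f (L (a + (q - 1) * l)) = L (a + q * l)"
      using tL tM by (simp_all add: translates_def algebra_simps)
    then show ?case using step2 automorphism_inj[OF f] line_vert[OF L] line_vert[OF M] by metis
  qed
  have "M i = L (i + a)" for i
  proof -
    \<comment> \<open>Any \<open>q\<close> with \<open>i\<close> between \<open>- q * l\<close> and \<open>q * l\<close> would do.\<close>
    define q where "q = \<bar>i\<bar>"
    have q: "0 \<le> q" "- (q * l) \<le> i" "i \<le> q * l"
    proof -
      have "q \<le> q * l" using l by (simp add: q_def mult_le_cancel_left1)
      then show "0 \<le> q" "- (q * l) \<le> i" "i \<le> q * l" by (auto simp: q_def)
    qed
    have "map M [- (q * l)..q * l] = map L [a - q * l..a + q * l]"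
      using step[of q] step[of "- q"] geo_line[OF M, of "- (q * l)" "q * l"]
        geo_line[OF L, of "a - q * l" "a + q * l"] q by simp
    then have "map M [- (q * l)..q * l] ! nat (i + q * l) = map L [a - q * l..a + q * l] ! nat (i + q * l)"
      by simp
    moreover have "map M [- m..m] ! nat (i + m) = M i" "map L [a - m..a + m] ! nat (i + m) = L (i + a)"
      if "- m \<le> i" "i \<le> m" for m
      using that by (simp_all add: add.commute)
    ultimately show ?thesis using q(2,3) by metis
  qed
  then show ?thesis by blast
qed

lemma line_automorphism:
  assumes f: "automorphism f" and L: "line L"
  shows "line (\<lambda>i. f (L i))"
  unfolding line_def
proof (intro allI conjI)
  fix i
  show "(f (L i), f (L (i + 1))) \<in> parcs T" using L automorphism_arc[OF f] by (simp add: line_def)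
  have "L i \<noteq> L (i + 2)" using L by (simp add: line_def)
  then show "f (L i) \<noteq> f (L (i + 2))"
    using automorphism_inj[OF f _ line_vert[OF L] line_vert[OF L]] by blast
qed

text \<open>The line \<open>g \<circ> L\<close> is translated by \<open>f\<close> as well, by the same amount, so it is a shift of \<open>L\<close>.\<close>

lemma commuting_translates:
  assumes f: "automorphism f" and g: "automorphism g"
    and comm: "\<And>x. x \<in> pverts T \<Longrightarrow> f (g x) = g (f x)"
    and L: "line L" and t: "translates f L l" and l: "l \<noteq> 0"
  shows "\<exists>k. translates g L k"
proof -
  have pos: "\<exists>k. translates g L k" if L: "line L" and t: "translates f L l" and l: "0 < l" for L l
  proof -
    have "translates f (\<lambda>i. g (L i)) l" using t comm line_vert[OF L] by (simp add: translates_def)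
    from axis_unique[OF f L line_automorphism[OF g L] t this l] show ?thesis
      by (auto simp: translates_def)
  qed
  show ?thesis
  proof (cases "0 < l")
    case True
    then show ?thesis using pos[OF L t] by blast
  next
    case False
    have "line (\<lambda>i. L (- i))"
      unfolding line_def
    proof (intro allI conjI)
      fix i
      show "(L (- i), L (- (i + 1))) \<in> parcs T"
        using L arcs_symmetric[of "L (- i - 1)" "L (- i)"] unfolding line_def
        by (metis add.commute diff_add_cancel minus_add_distrib uminus_add_conv_diff)
      show "L (- i) \<noteq> L (- (i + 2))" using line_inj[OF L, of "- i" "- (i + 2)"] by auto
    qed
    moreover have "translates f (\<lambda>i. L (- i)) (- l)" using t by (simp add: translates_def)
    ultimately obtain k where "translates g (\<lambda>i. L (- i)) k" using pos False l by force
    then have k: "g (L (- i)) = L (- (i + k))" for i by (simp add: translates_def)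
    have "translates g L (- k)" using k[of "- i" for i] by (simp add: translates_def)
    then show ?thesis by blast
  qed
qed

end

section \<open>Separation by a vertex set\<close>

text \<open>For a symmetric relation the predicate \<open>P\<close> singles out a union of connected components of
  the graph with the vertices in \<open>S\<close> removed, which is neither empty nor everything. Components
  themselves are avoided because the arguments below produce such a two-colouring directly.\<close>

definition separated :: "'v set \<Rightarrow> 'v rel \<Rightarrow> 'v set \<Rightarrow> bool" where
  "separated V E S \<longleftrightarrow> (\<exists>P. (\<exists>u\<in>V - S. P u) \<and> (\<exists>v\<in>V - S. \<not> P v) \<and>
     (\<forall>a b. (a, b) \<in> E \<longrightarrow> a \<notin> S \<longrightarrow> b \<notin> S \<longrightarrow> P a \<longrightarrow> P b))"

lemma separatedI:
  assumes "u \<in> V - S" "P u" "v \<in> V - S" "\<not> P v"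
    and "\<And>a b. (a, b) \<in> E \<Longrightarrow> a \<notin> S \<Longrightarrow> b \<notin> S \<Longrightarrow> P a \<Longrightarrow> P b"
  shows "separated V E S"
  unfolding separated_def using assms by (intro exI[of _ P] conjI) blast+

lemma separatedE:
  assumes "separated V E S"
  obtains P u v where "u \<in> V - S" "P u" "v \<in> V - S" "\<not> P v"
    "\<And>a b. (a, b) \<in> E \<Longrightarrow> a \<notin> S \<Longrightarrow> b \<notin> S \<Longrightarrow> P a \<Longrightarrow> P b"
proof -
  obtain P where P: "\<exists>u\<in>V - S. P u" "\<exists>v\<in>V - S. \<not> P v"
    and step: "\<forall>a b. (a, b) \<in> E \<longrightarrow> a \<notin> S \<longrightarrow> b \<notin> S \<longrightarrow> P a \<longrightarrow> P b"
    using assms unfolding separated_def by (elim exE conjE)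
  obtain u v where "u \<in> V - S" "P u" "v \<in> V - S" "\<not> P v" using P by (elim bexE)
  then show thesis by (rule that) (use step in simp)
qed

section \<open>Groups acting on a tree\<close>

context splitting
begin

lemma group_G: "group G"
  using group_hom by (rule group_hom.axioms(1))

lemma automorphism_action: "g \<in> carrier G \<Longrightarrow> automorphism (\<rho> g)"
  using bij_prop0[of g] edge_preserving[of g] by (simp add: automorphism_def Bij_def)

lemma action_one: "x \<in> pverts T \<Longrightarrow> \<rho> \<one>\<^bsub>G\<^esub> x = x"
  using id_eq_one by (metis restrict_apply')

lemma action_inv:
  assumes "g \<in> carrier G" "x \<in> pverts T" "\<rho> g x = y"
  shows "\<rho> (inv\<^bsub>G\<^esub> g) y = x"
  using orbit_sym_aux[OF assms] .

text \<open>At a vertex \<open>x\<close> of minimal displacement the geodesic to \<open>g x\<close> continues into its image without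
  backtracking. Otherwise the second vertex of the geodesic would be displaced by two less; if the
  geodesic is a single edge, \<open>g\<close> would invert it.\<close>

lemma no_return:
  assumes g: "g \<in> carrier G" and moves: "\<And>y. y \<in> pverts T \<Longrightarrow> \<rho> g y \<noteq> y"
    and x: "x \<in> pverts T"
    and min: "\<And>y. y \<in> pverts T \<Longrightarrow> length (geo x (\<rho> g x)) \<le> length (geo y (\<rho> g y))"
  shows "\<rho> g (geo x (\<rho> g x) ! 1) \<noteq> geo x (\<rho> g x) ! (length (geo x (\<rho> g x)) - 2)"
proof
  define p where "p = geo x (\<rho> g x)"
  have gx: "\<rho> g x \<in> pverts T" using automorphism_vert[OF automorphism_action[OF g] x] .
  have red: "reduced_walk T p" and hd: "hd p = x" and lst: "last p = \<rho> g x" and ne: "p \<noteq> []"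
    using geo[OF x gx] geo_not_Nil[OF x gx] by (simp_all add: p_def)
  have "length p \<noteq> 1"
  proof
    assume "length p = 1"
    then obtain a where "p = [a]" by (auto simp: length_Suc_conv)
    then show False using hd lst moves[OF x] by simp
  qed
  then have len: "2 \<le> length p" using ne by (cases p; cases "tl p") auto
  assume "\<rho> g (geo x (\<rho> g x) ! 1) = geo x (\<rho> g x) ! (length (geo x (\<rho> g x)) - 2)"
  then have turn: "\<rho> g (p ! 1) = p ! (length p - 2)" by (simp add: p_def)
  show False
  proof (cases "length p = 2")
    case True
    then obtain a b where p: "p = [a, b]" by (auto simp: length_Suc_conv numeral_2_eq_2)
    have "(x, \<rho> g x) \<in> parcs T" using red hd lst p by simp
    moreover have "\<rho> g (\<rho> g x) = x" using turn hd lst p by simp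
    ultimately show False using no_inversions[OF g] by blast
  next
    case False
    define m where "m = tl (butlast p)"
    have m: "m \<noteq> []" "length m = length p - 2" using len False by (auto simp: m_def simp flip: length_0_conv)
    obtain r where r: "p = x # r" using hd ne by (cases p) auto
    have "r \<noteq> []" using r len by auto
    then have "r = butlast r @ [\<rho> g x]" using lst r by (metis append_butlast_last_id last_ConsR)
    then have pm: "p = x # m @ [\<rho> g x]" using r \<open>r \<noteq> []\<close> by (simp add: m_def)
    have y: "p ! 1 = hd m" using m by (simp add: pm hd_conv_nth nth_append)
    have z: "p ! (length p - 2) = last m"
    proof -
      have "p ! length m = (x # m) ! length m"
        unfolding pm using nth_append[of "x # m" "[\<rho> g x]" "length m"] by simp
      also have "\<dots> = last m" using last_conv_nth[of "x # m"] m(1) by simp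
      finally show ?thesis unfolding m(2) .
    qed
    have "reduced_walk T (x # m)" using reduced_walk_prefix[of "x # m" "[\<rho> g x]"] red pm by simp
    then have rm: "reduced_walk T m" using reduced_walk_tl[of x "hd m" "tl m"] m by simp
    have "geo (p ! 1) (\<rho> g (p ! 1)) = m" using geo_eqI[OF rm] y z turn by simp
    moreover have "p ! 1 \<in> pverts T" using reduced_walk_verts[OF rm] m y by (auto intro: hd_in_set)
    ultimately show False using min[of "p ! 1"] m len by (simp flip: p_def)
  qed
qed

text \<open>The axis is the concatenation of all translates, under the powers of \<open>g\<close>, of the geodesic
  from a vertex \<open>x\<close> of minimal displacement to \<open>g x\<close>.\<close>

lemma axis_exists:
  assumes g: "g \<in> carrier G" and moves: "\<And>y. y \<in> pverts T \<Longrightarrow> \<rho> g y \<noteq> y"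
  shows "\<exists>L l. line L \<and> 0 < l \<and> translates (\<rho> g) L l"
proof -
  interpret group G by (rule group_G)
  have "pverts T \<noteq> {}"
    using tree_connected by (auto simp: connected_def strongly_connected_def mk_symmetric_def)
  then obtain x where x: "x \<in> pverts T"
    and min: "\<And>y. y \<in> pverts T \<Longrightarrow> length (geo x (\<rho> g x)) \<le> length (geo y (\<rho> g y))"
    using ex_has_least_nat[of "\<lambda>y. y \<in> pverts T" _ "\<lambda>y. length (geo y (\<rho> g y))"] by blast
  define p where "p = geo x (\<rho> g x)"
  define l where "l = int (length p) - 1"
  have gx: "\<rho> g x \<in> pverts T" using automorphism_vert[OF automorphism_action[OF g] x] .
  have red: "reduced_walk T p" and hd: "hd p = x" and lst: "last p = \<rho> g x" and ne: "p \<noteq> []"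
    using geo[OF x gx] geo_not_Nil[OF x gx] by (simp_all add: p_def)
  have l0: "0 \<le> l" using ne by (cases p) (simp_all add: l_def)
  have p0: "p ! 0 = x" using hd ne by (simp add: hd_conv_nth)
  have "nat l = length p - 1" unfolding l_def by arith
  then have pl: "p ! nat l = \<rho> g x" using lst ne by (simp add: last_conv_nth)
  have "l \<noteq> 0" using p0 pl moves[OF x] by auto
  then have l: "0 < l" using l0 by simp
  have pV: "p ! nat r \<in> pverts T" if "0 \<le> r" "r \<le> l" for r
    using that reduced_walk_verts[OF red] l by (intro subsetD[OF _ nth_mem]) (auto simp: l_def)
  define A where "A q = \<rho> (g [^]\<^bsub>G\<^esub> q)" for q :: int
  have autA: "automorphism (A q)" for q using g by (simp add: A_def automorphism_action)
  have A_l: "A (q + 1) y = \<rho> g (A q y)" and A_r: "A (q + 1) y = A q (\<rho> g y)" if "y \<in> pverts T" for q y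
  proof -
    have "g [^]\<^bsub>G\<^esub> (q + 1) = g [^]\<^bsub>G\<^esub> q \<otimes>\<^bsub>G\<^esub> g"
      using g int_pow_mult[of g q 1] by simp
    then show "A (q + 1) y = A q (\<rho> g y)" using g that composition_rule by (simp add: A_def)
    have "g [^]\<^bsub>G\<^esub> (q + 1) = g \<otimes>\<^bsub>G\<^esub> g [^]\<^bsub>G\<^esub> q"
      using g int_pow_mult[of g 1 q] by (simp add: add.commute)
    then show "A (q + 1) y = \<rho> g (A q y)" using g that composition_rule by (simp add: A_def)
  qed
  \<comment> \<open>The vertices at multiples of \<open>l\<close> belong to two translates of the geodesic, which agree there;
    so the next formula also holds for the remainder \<open>l\<close>.\<close>
  define L where "L i = A (i div l) (p ! nat (i mod l))" for i
  have L: "L (q * l + r) = A q (p ! nat r)" if "0 \<le> r" "r \<le> l" for q r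
  proof (cases "r = l")
    case True
    have "q * l + r = (q + 1) * l" using True by (simp add: algebra_simps)
    then have "L (q * l + r) = A (q + 1) x" using l by (simp add: L_def p0)
    then show ?thesis using A_r[OF x] True pl by simp
  next
    case False
    then have "(q * l + r) div l = q" "(q * l + r) mod l = r"
      using that l by (simp_all add: div_pos_pos_trivial)
    then show ?thesis by (simp add: L_def)
  qed
  have arc: "(p ! nat r, p ! nat (r + 1)) \<in> parcs T" if "0 \<le> r" "r < l" for r
    using reduced_walk_nth_arc[OF red, of "nat r"] that by (simp add: l_def nat_add_distrib)
  have "line L"
    unfolding line_def
  proof (intro allI conjI)
    fix i
    define q r where "q = i div l" and "r = i mod l"
    have i: "i = q * l + r" and r: "0 \<le> r" "r < l" using l by (simp_all add: q_def r_def)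
    have Li: "L i = A q (p ! nat r)" using L[of r q] r i by simp
    have Li1: "L (i + 1) = A q (p ! nat (r + 1))" using L[of "r + 1" q] r i by (simp add: add.assoc)
    show "(L i, L (i + 1)) \<in> parcs T"
      unfolding Li Li1 using automorphism_arc[OF autA arc[OF r]] .
    show "L i \<noteq> L (i + 2)"
    proof
      assume eq: "L i = L (i + 2)"
      show False
      proof (cases "r + 2 \<le> l")
        case True
        then have "L (i + 2) = A q (p ! nat (r + 2))" using L[of "r + 2" q] r i by (simp add: add.assoc)
        then have "p ! nat r = p ! nat (r + 2)"
          using eq Li automorphism_inj[OF autA, of q] pV True r by simp
        then have "nat r = nat (r + 2)"
          using nth_eq_iff_index_eq[OF reduced_walk_distinct[OF red], of "nat r" "nat (r + 2)"] True r
          by (simp add: l_def)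
        then show False using r by simp
      next
        case False
        then have rl: "r = l - 1" using r by simp
        have "i + 2 = (q + 1) * l + 1" using i rl by (simp add: algebra_simps)
        then have "L (i + 2) = A (q + 1) (p ! nat 1)" using L[of 1 "q + 1"] l unfolding \<open>i + 2 = _\<close> by simp
        then have "A q (p ! nat r) = A q (\<rho> g (p ! nat 1))" using eq Li A_r pV[of 1] l by simp
        then have "p ! nat r = \<rho> g (p ! nat 1)"
          using automorphism_inj[OF autA, of q] pV[of r] pV[of 1] r l
            automorphism_vert[OF automorphism_action[OF g]] by simp
        moreover have "nat r = length p - 2" using rl by (simp add: l_def nat_diff_distrib)
        ultimately show False using no_return[OF g moves x min] by (simp flip: p_def)
      qed
    qed
  qed
  moreover have "translates (\<rho> g) L l"
    unfolding translates_def
  proof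
    fix i
    have "0 \<le> i mod l" "i mod l \<le> l" using l by (simp_all add: less_imp_le)
    then have "\<rho> g (L i) = A (i div l + 1) (p ! nat (i mod l))"
      using A_l pV by (simp add: L_def)
    then show "\<rho> g (L i) = L (i + l)" using l by (simp add: L_def)
  qed
  ultimately show ?thesis using l by blast
qed

lemma translates_unique:
  assumes "line L" "translates f L k" "translates f L k'"
  shows "k = k'"
  using assms(2,3) line_inj[OF assms(1), of k k'] unfolding translates_def by (metis add_0)

lemma translates_mult:
  assumes "line L" "g \<in> carrier G" "h \<in> carrier G" "translates (\<rho> g) L k" "translates (\<rho> h) L m"
  shows "translates (\<rho> (g \<otimes>\<^bsub>G\<^esub> h)) L (k + m)"
  using assms composition_rule[OF line_vert[OF assms(1)] assms(2,3)]
  by (simp add: translates_def algebra_simps)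

lemma subgroup_translations:
  assumes L: "line L"
  shows "subgroup {g \<in> carrier G. \<exists>k. translates (\<rho> g) L k} G"
proof -
  interpret group G by (rule group_G)
  show ?thesis
  proof (rule subgroupI)
    have "translates (\<rho> \<one>\<^bsub>G\<^esub>) L 0" using action_one line_vert[OF L] by (simp add: translates_def)
    then show "{g \<in> carrier G. \<exists>k. translates (\<rho> g) L k} \<noteq> {}" using one_closed by blast
  next
    fix g assume "g \<in> {g \<in> carrier G. \<exists>k. translates (\<rho> g) L k}"
    then obtain k where g: "g \<in> carrier G" "translates (\<rho> g) L k" by blast
    have "translates (\<rho> (inv\<^bsub>G\<^esub> g)) L (- k)"
      using action_inv[OF g(1) line_vert[OF L], of "i - k" "L i" for i] g(2)
      by (simp add: translates_def)
    then show "inv\<^bsub>G\<^esub> g \<in> {g \<in> carrier G. \<exists>k. translates (\<rho> g) L k}" using g by blast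
  qed (use translates_mult[OF L] in blast)+
qed

lemma translation_hom:
  assumes L: "line L" and tr: "\<And>g. g \<in> carrier G \<Longrightarrow> \<exists>k. translates (\<rho> g) L k"
  shows "\<exists>\<phi>\<in>hom G integer_group. \<forall>g\<in>carrier G. translates (\<rho> g) L (\<phi> g)"
proof -
  define \<phi> where "\<phi> g = (THE k. translates (\<rho> g) L k)" for g
  have \<phi>: "\<phi> g = k" if "translates (\<rho> g) L k" for g k
    unfolding \<phi>_def by (rule the_equality) (use that translates_unique[OF L] in blast)+
  have t: "translates (\<rho> g) L (\<phi> g)" if "g \<in> carrier G" for g
    using tr[OF that] \<phi> by auto
  have "\<phi> (g \<otimes>\<^bsub>G\<^esub> h) = \<phi> g + \<phi> h" if "g \<in> carrier G" "h \<in> carrier G" for g h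
    using \<phi>[OF translates_mult[OF L that t[OF that(1)] t[OF that(2)]]] .
  then have "\<phi> \<in> hom G integer_group" by (intro homI) simp_all
  then show ?thesis using t by blast
qed

lemma fixed_vertex_point:
  assumes x: "x \<in> pverts T" and fixed: "\<And>g. g \<in> carrier G \<Longrightarrow> \<rho> g x = x"
  shows "\<exists>p\<in>tree_points T. \<forall>g\<in>carrier G. fixes_point \<rho> T g p"
proof (intro bexI ballI)
  let ?p = "\<lambda>v. if v = x then 1 else 0 :: real"
  have "{v. ?p v \<noteq> 0} = {x}" by auto
  then show "?p \<in> tree_points T" using x by (auto simp: tree_points_def)
  fix g assume g: "g \<in> carrier G"
  have "\<rho> g v = x \<longleftrightarrow> v = x" if "v \<in> pverts T" for v
    using automorphism_inj[OF automorphism_action[OF g] _ that x] fixed[OF g] by auto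
  then show "fixes_point \<rho> T g ?p" by (simp add: fixes_point_def)
qed

end

section \<open>Commuting generators acting on a tree\<close>

context splitting
begin

text \<open>Call a generator good if it translates \<open>L\<close>, possibly by zero. A generator that commutes with one
  translating \<open>L\<close> nontrivially is good. So either all generators are good, and then the whole group
  acts on \<open>L\<close> by translations; or the generators that fix \<open>L\<close> pointwise separate the other good
  generators, among them \<open>s\<close>, from the bad ones.\<close>

lemma hyperbolic_alternative:
  assumes \<gamma>: "\<And>v. v \<in> V \<Longrightarrow> \<gamma> v \<in> carrier G"
    and gen: "\<And>H. subgroup H G \<Longrightarrow> \<gamma> ` V \<subseteq> H \<Longrightarrow> carrier G \<subseteq> H"
    and comm: "\<And>u v. (u, v) \<in> E \<Longrightarrow> u \<in> V \<and> v \<in> V \<and> \<gamma> u \<otimes>\<^bsub>G\<^esub> \<gamma> v = \<gamma> v \<otimes>\<^bsub>G\<^esub> \<gamma> u"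
    and s: "s \<in> V" and L: "line L" and ts: "translates (\<rho> (\<gamma> s)) L l" and l: "l \<noteq> 0"
  shows "(\<exists>\<phi>\<in>hom G integer_group. \<forall>g\<in>kernel G integer_group \<phi>. translates (\<rho> g) L 0) \<or>
    separated V E {v \<in> V. translates (\<rho> (\<gamma> v)) L 0}"
proof (cases "\<forall>v\<in>V. \<exists>k. translates (\<rho> (\<gamma> v)) L k")
  case True
  then have "carrier G \<subseteq> {g \<in> carrier G. \<exists>k. translates (\<rho> g) L k}"
    using \<gamma> by (intro gen subgroup_translations[OF L]) auto
  then obtain \<phi> where "\<phi> \<in> hom G integer_group" "\<forall>g\<in>carrier G. translates (\<rho> g) L (\<phi> g)"
    using translation_hom[OF L] by blast
  then show ?thesis by (intro disjI1 bexI[of _ \<phi>]) (auto simp: kernel_def)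
next
  case False
  define S where "S = {v \<in> V. translates (\<rho> (\<gamma> v)) L 0}"
  define P where "P v \<longleftrightarrow> (\<exists>k. translates (\<rho> (\<gamma> v)) L k)" for v
  obtain v where v: "v \<in> V" "\<not> P v" using False by (auto simp: P_def)
  have "v \<notin> S" using v by (auto simp: S_def P_def)
  have "s \<notin> S" using translates_unique[OF L ts] l by (auto simp: S_def)
  have "P b" if e: "(a, b) \<in> E" and a: "a \<notin> S" "P a" for a b
  proof -
    obtain k where k: "translates (\<rho> (\<gamma> a)) L k" using a by (auto simp: P_def)
    have ab: "\<gamma> a \<in> carrier G" "\<gamma> b \<in> carrier G" "a \<in> V" using comm[OF e] \<gamma> by auto
    have "k \<noteq> 0" using k a ab by (auto simp: S_def)
    moreover have "\<rho> (\<gamma> a) (\<rho> (\<gamma> b) x) = \<rho> (\<gamma> b) (\<rho> (\<gamma> a) x)" if "x \<in> pverts T" for x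
      using composition_rule[OF that ab(1,2)] composition_rule[OF that ab(2,1)] comm[OF e] by simp
    ultimately show "P b"
      using commuting_translates[OF automorphism_action automorphism_action _ L k] ab
      by (auto simp: P_def)
  qed
  moreover have "P s" using ts by (auto simp: P_def)
  ultimately have "separated V E S"
    using v \<open>v \<notin> S\<close> \<open>s \<notin> S\<close> s by (intro separatedI[of s V S P v E]) simp_all
  then show ?thesis by (simp add: S_def)
qed

text \<open>The fixed subtrees of the generators have no common vertex, so some edge separates two of them.
  The fixed subtree of a generator that does not fix this edge lies on one side of it, and it lies on
  the same side for two such generators that commute, as their fixed subtrees meet.\<close>

lemma elliptic_alternative:
  assumes fin: "finite V"
    and \<gamma>: "\<And>v. v \<in> V \<Longrightarrow> \<gamma> v \<in> carrier G"
    and gen: "\<And>H. subgroup H G \<Longrightarrow> \<gamma> ` V \<subseteq> H \<Longrightarrow> carrier G \<subseteq> H"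
    and comm: "\<And>u v. (u, v) \<in> E \<Longrightarrow> u \<in> V \<and> v \<in> V \<and> \<gamma> u \<otimes>\<^bsub>G\<^esub> \<gamma> v = \<gamma> v \<otimes>\<^bsub>G\<^esub> \<gamma> u"
    and ell: "\<And>v. v \<in> V \<Longrightarrow> \<exists>x\<in>pverts T. \<rho> (\<gamma> v) x = x"
    and nofix: "\<And>x. x \<in> pverts T \<Longrightarrow> \<exists>g\<in>carrier G. \<rho> g x \<noteq> x"
  shows "\<exists>x y. (x, y) \<in> parcs T \<and> separated V E {v \<in> V. \<rho> (\<gamma> v) x = x \<and> \<rho> (\<gamma> v) y = y}"
proof -
  define F where "F v = {x \<in> pverts T. \<rho> (\<gamma> v) x = x}" for v
  have F: "convex (F v)" "F v \<noteq> {}" if "v \<in> V" for v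
    using convex_fixed_set[OF automorphism_action[OF \<gamma>[OF that]]] ell[OF that] by (auto simp: F_def)
  have meet: "F a \<inter> F b \<noteq> {}" if "(a, b) \<in> E" for a b
  proof -
    have ab: "a \<in> V" "b \<in> V" "\<gamma> a \<in> carrier G" "\<gamma> b \<in> carrier G" using comm[OF that] \<gamma> by auto
    have "\<rho> (\<gamma> a) (\<rho> (\<gamma> b) x) = \<rho> (\<gamma> b) (\<rho> (\<gamma> a) x)" if x: "x \<in> pverts T" for x
      using composition_rule[OF x ab(3,4)] composition_rule[OF x ab(4,3)] comm[OF \<open>(a, b) \<in> E\<close>] by simp
    moreover obtain xa xb where "xa \<in> pverts T" "\<rho> (\<gamma> a) xa = xa" "xb \<in> pverts T" "\<rho> (\<gamma> b) xb = xb"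
      using ell ab by blast
    ultimately show ?thesis
      using commuting_fixed_sets[OF automorphism_action[OF ab(3)] automorphism_action[OF ab(4)]]
      by (fastforce simp: F_def)
  qed
  have "x \<notin> (\<Inter>v\<in>V. F v)" if x: "x \<in> pverts T" for x
  proof
    assume *: "x \<in> (\<Inter>v\<in>V. F v)"
    have "carrier G \<subseteq> stabilizer G \<rho> x"
      using * \<gamma> by (intro gen stabilizer_subgroup[OF x]) (auto simp: stabilizer_def F_def)
    then show False using nofix[OF x] by (auto simp: stabilizer_def)
  qed
  moreover have ne: "V \<noteq> {}"
  proof
    assume "V = {}"
    moreover obtain x where x: "x \<in> pverts T"
      using tree_connected by (auto simp: connected_def strongly_connected_def mk_symmetric_def)
    ultimately have "carrier G \<subseteq> stabilizer G \<rho> x" by (intro gen stabilizer_subgroup) auto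
    then show False using nofix[OF x] by (auto simp: stabilizer_def)
  qed
  ultimately have "(\<Inter>v\<in>V. F v) = {}" by (auto simp: F_def)
  from separating_edge[OF fin ne F this]
  obtain x y u v where e: "(x, y) \<in> parcs T" and uv: "u \<in> V" "v \<in> V"
    and Fu: "\<And>z. z \<in> F u \<Longrightarrow> across y x z" and Fv: "\<And>z. z \<in> F v \<Longrightarrow> across x y z" by blast
  have xyV: "x \<in> pverts T" "y \<in> pverts T" using in_arcsD1[OF e] in_arcsD2[OF e] .
  have excl: False if "across x y z" "across y x z" for z
  proof -
    have "length (geo x z) = length (geo x z) + 2" 
      using arg_cong[OF across_geo[OF that(1)], of length] arg_cong[OF across_geo[OF that(2)], of length] by simp
    then show False by simp
  qed
  have side: "(\<forall>z\<in>F w. across y x z) \<or> (\<forall>z\<in>F w. across x y z)"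
    if w: "w \<in> V" "\<not> (x \<in> F w \<and> y \<in> F w)" for w
  proof (rule ccontr)
    assume "\<not> ?thesis"
    then obtain z z' where z: "z \<in> F w" "\<not> across y x z" "z' \<in> F w" "\<not> across x y z'" by blast
    have zV: "z \<in> pverts T" "z' \<in> pverts T" using z by (auto simp: F_def)
    have "across x y z" "across y x z'" using across_cases[OF e] z zV by blast+
    from across_concat[OF this(2,1)] have "x \<in> set (geo z' z)" "y \<in> set (geo z' z)"
      using end_in_geo[of z' x] start_in_geo[of y z] xyV zV by auto
    moreover have "set (geo z' z) \<subseteq> F w" using F(1)[OF w(1)] z by (auto simp: convex_def)
    ultimately show False using w(2) by blast
  qed
  define P where "P w \<longleftrightarrow> (\<forall>z\<in>F w. across y x z)" for w
  have yx: "\<not> across y x y" "\<not> across x y x"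
    using geo_eqI[of "[x]" x x] geo_eqI[of "[y]" y y] geo_not_Nil[OF xyV] geo_not_Nil[OF xyV(2,1)] xyV
    by (auto simp: across_def)
  have 1: "\<not> (x \<in> F u \<and> y \<in> F u)" "\<not> (x \<in> F v \<and> y \<in> F v)" using Fu Fv yx by blast+
  have 2: "P u" "\<not> P v" using Fu Fv excl F(2)[OF uv(2)] by (auto simp: P_def)
  have 3: "P b" if ab: "(a, b) \<in> E" "\<not> (x \<in> F b \<and> y \<in> F b)" "P a" for a b
  proof -
    obtain z where z: "z \<in> F a" "z \<in> F b" using meet[OF ab(1)] by blast
    then have "\<not> across x y z" using ab(3) excl by (auto simp: P_def)
    then show "P b" using side[of b] comm[OF ab(1)] ab(2) z by (auto simp: P_def)
  qed
  have "separated V E {w \<in> V. x \<in> F w \<and> y \<in> F w}"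
    using uv 1 2 3 comm by (intro separatedI[of u V _ P v E]) auto
  then show ?thesis using e xyV by (auto simp: F_def)
qed

end

section \<open>Right-angled Artin groups\<close>

lemma raag_gen_carrier: "v \<in> pverts \<Gamma> \<Longrightarrow> raag_gen \<Gamma> v \<in> carrier (raag \<Gamma>)"
  by (auto simp: raag_gen_def raag_def presented_group_def intro: quotientI)

text \<open>Both \<open>u v\<close> and \<open>v u\<close> are obtained from the relator followed by \<open>v u\<close>: the former by
  cancellation, the latter by dropping the relator.\<close>

lemma raag_gen_commute:
  assumes "pair_graph \<Gamma>" and e: "(u, v) \<in> parcs \<Gamma>"
  shows "raag_gen \<Gamma> u \<otimes>\<^bsub>raag \<Gamma>\<^esub> raag_gen \<Gamma> v = raag_gen \<Gamma> v \<otimes>\<^bsub>raag \<Gamma>\<^esub> raag_gen \<Gamma> u"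
proof -
  interpret pair_graph \<Gamma> by fact
  have uv: "u \<in> pverts \<Gamma>" "v \<in> pverts \<Gamma>" using e in_arcsD1 in_arcsD2 by auto
  let ?S = "pverts \<Gamma>" and ?R = "raag_relators \<Gamma>"
  let ?r = "[(u, True), (v, True), (u, False), (v, False)]"
  have r: "?r \<in> ?R" using e by (auto simp: raag_relators_def)
  have 1: "pres_eq ?S ?R (?r @ [(v, True), (u, True)]) [(v, True), (u, True)]"
    using pres_eq.relator[of "[]" ?S "[(v, True), (u, True)]" ?r ?R] uv r by simp
  have 2: "pres_eq ?S ?R (?r @ [(v, True), (u, True)]) [(u, True), (v, True), (u, False), (u, True)]"
    using pres_eq.cancel[of "[(u, True), (v, True), (u, False)]" ?S "[(u, True)]" v ?R False] uv by simp
  have 3: "pres_eq ?S ?R [(u, True), (v, True), (u, False), (u, True)] [(u, True), (v, True)]"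
    using pres_eq.cancel[of "[(u, True), (v, True)]" ?S "[]" u ?R False] uv by simp
  have "pres_eq ?S ?R [(u, True), (v, True)] [(v, True), (u, True)]"
    using pres_eq.trans[OF pres_eq.sym[OF pres_eq.trans[OF 2 3]] 1] .
  then have "pres_rel ?S ?R `` {[(u, True), (v, True)]} = pres_rel ?S ?R `` {[(v, True), (u, True)]}"
    by (intro equiv_class_eq[OF equiv_pres_rel]) (simp add: pres_rel_iff)
  then show ?thesis using uv by (simp add: raag_gen_def raag_def presented_group_mult_class)
qed

lemma raag_generated:
  assumes H: "subgroup H (raag \<Gamma>)" and gens: "raag_gen \<Gamma> ` pverts \<Gamma> \<subseteq> H"
  shows "carrier (raag \<Gamma>) \<subseteq> H"
proof -
  let ?S = "pverts \<Gamma>" and ?R = "raag_relators \<Gamma>"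
  let ?c = "\<lambda>w. pres_rel ?S ?R `` {w}"
  interpret group "raag \<Gamma>" unfolding raag_def by (rule group_presented_group)
  have one: "\<one>\<^bsub>raag \<Gamma>\<^esub> = ?c []" by (simp add: raag_def presented_group_def)
  have letter: "?c [(x, b)] \<in> H" if x: "x \<in> ?S" for x b
  proof (cases b)
    case True
    then show ?thesis using gens x by (auto simp: raag_gen_def)
  next
    case False
    have "?c [(x, False)] \<otimes>\<^bsub>raag \<Gamma>\<^esub> raag_gen \<Gamma> x = ?c [(x, False), (x, True)]"
      using x by (simp add: raag_gen_def raag_def presented_group_mult_class)
    also have "\<dots> = ?c []"
      using pres_eq.cancel[of "[]" ?S "[]" x ?R False] x
      by (intro equiv_class_eq[OF equiv_pres_rel]) (simp add: pres_rel_iff)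
    finally have "?c [(x, False)] \<otimes>\<^bsub>raag \<Gamma>\<^esub> raag_gen \<Gamma> x = \<one>\<^bsub>raag \<Gamma>\<^esub>" by (simp only: one)
    moreover have "?c [(x, False)] \<in> carrier (raag \<Gamma>)"
      using x by (auto simp: raag_def presented_group_def intro: quotientI)
    ultimately have "inv\<^bsub>raag \<Gamma>\<^esub> raag_gen \<Gamma> x = ?c [(x, False)]"
      using inv_equality raag_gen_carrier[OF x] by blast
    then show ?thesis using False subgroup.m_inv_closed[OF H, of "raag_gen \<Gamma> x"] gens x by auto
  qed
  have "w \<in> words ?S \<Longrightarrow> ?c w \<in> H" for w
  proof (induction w)
    case Nil
    then show ?case using subgroup.one_closed[OF H] one by simp
  next
    case (Cons a w)
    have "?c (a # w) = ?c [a] \<otimes>\<^bsub>raag \<Gamma>\<^esub> ?c w"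
      using Cons.prems presented_group_mult_class[of "[a]" ?S w ?R] by (simp add: raag_def)
    then show ?case using Cons letter[of "fst a" "snd a"] subgroup.m_closed[OF H] by simp
  qed
  then show ?thesis by (auto simp: raag_def presented_group_def elim!: quotientE)
qed

text \<open>No walk in the complement of \<open>S\<close> leads from the vertices satisfying \<open>P\<close> to the others, so the
  components of vertices of both kinds differ.\<close>

lemma separating_induced_subgraph:
  assumes "pair_graph \<Gamma>" and S: "S \<subseteq> pverts \<Gamma>" and sep: "separated (pverts \<Gamma>) (parcs \<Gamma>) S"
  shows "separating_subgraph \<lparr>pverts = S, parcs = parcs \<Gamma> \<inter> S \<times> S\<rparr> \<Gamma>"
proof -
  interpret pair_graph \<Gamma> by fact
  let ?D = "with_proj \<Gamma> \<restriction> (pverts \<Gamma> - S)"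
  have "with_proj \<lparr>pverts = S, parcs = parcs \<Gamma> \<inter> S \<times> S\<rparr> = with_proj \<Gamma> \<restriction> S"
    by (auto simp: with_proj_def induce_subgraph_def)
  then have ind: "induced_subgraph (with_proj \<lparr>pverts = S, parcs = parcs \<Gamma> \<inter> S \<times> S\<rparr>) (with_proj \<Gamma>)"
    using induced_induce[of S] S by simp
  obtain P u v where u: "u \<in> pverts \<Gamma> - S" "P u" and v: "v \<in> pverts \<Gamma> - S" "\<not> P v"
    and P: "\<And>a b. (a, b) \<in> parcs \<Gamma> \<Longrightarrow> a \<notin> S \<Longrightarrow> b \<notin> S \<Longrightarrow> P a \<Longrightarrow> P b"
    using sep by (rule separatedE) (rule that)
  interpret D: fin_digraph ?D
    by unfold_locales (auto simp: pair_finite_verts pair_finite_arcs intro: in_arcsD1 in_arcsD2)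
  have step: "P y" if "(x, y) \<in> arcs_ends ?D" "P x" for x y
    using that P by (auto simp: arcs_ends_conv)
  have "P y" if "reachable ?D x y" "P x" for x y
    using that by (induction rule: D.reachable_induct) (auto intro: step)
  then have "\<not> reachable ?D u v" using u v by blast
  then have "v \<notin> D.scc_of u" by (simp add: D.scc_of_def)
  moreover have "v \<in> D.scc_of v" using v by (intro D.in_scc_of_self) simp
  ultimately have "D.scc_of u \<noteq> D.scc_of v" by blast
  then have "card {D.scc_of u, D.scc_of v} = 2" by simp
  moreover have "{D.scc_of u, D.scc_of v} \<subseteq> D.sccs_verts"
    using D.scc_of_in_sccs_verts u v by simp
  ultimately have "2 \<le> card D.sccs_verts" using card_mono[OF D.finite_sccs_verts] by metis
  then show ?thesis using ind by (simp add: separating_subgraph_def disconnected_def D.card_sccs_verts)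
qed

lemma (in splitting) edge_fixator_subset:
  "{g \<in> carrier G. \<rho> g x = x \<and> \<rho> g y = y} \<subseteq> edge_stabilizer G \<rho> (x, y)"
  by (auto simp: edge_stabilizer_def)

lemma (in splitting) edge_fixator_subgroup:
  assumes "x \<in> pverts T" "y \<in> pverts T"
  shows "subgroup {g \<in> carrier G. \<rho> g x = x \<and> \<rho> g y = y} G"
proof -
  interpret group G by (rule group_G)
  have "{g \<in> carrier G. \<rho> g x = x \<and> \<rho> g y = y} = stabilizer G \<rho> x \<inter> stabilizer G \<rho> y"
    by (auto simp: stabilizer_def)
  then show ?thesis using subgroups_Inter_pair[OF stabilizer_subgroup stabilizer_subgroup] assms by simp
qed

theorem corollary2:
  fixes \<Gamma> :: "'v pair_pre_digraph" and \<A> :: "'v word set set set"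
  assumes "pair_graph \<Gamma>" and "connected (with_proj \<Gamma>)"
    and "subgroup_family (raag \<Gamma>) \<A>"
    and "closed_under_subgroups (raag \<Gamma>) \<A>"
    and "\<exists>(T :: 't pair_pre_digraph) \<rho>.
           splitting_over (raag \<Gamma>) \<A> T \<rho> \<and> nontrivial_splitting (raag \<Gamma>) T \<rho>"
  shows "(\<exists>\<phi> \<in> hom (raag \<Gamma>) integer_group. kernel (raag \<Gamma>) integer_group \<phi> \<in> \<A>) \<or>
         (\<exists>\<Lambda>. separating_subgraph \<Lambda> \<Gamma> \<and> raag_subgroup \<Gamma> \<Lambda> \<in> \<A>)"
proof -
  let ?G = "raag \<Gamma>" and ?V = "pverts \<Gamma>" and ?E = "parcs \<Gamma>"
  interpret \<Gamma>: pair_graph \<Gamma> by fact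
  obtain T :: "'t pair_pre_digraph" and \<rho> where sp: "splitting ?G T \<rho>"
    and edges: "\<And>e. e \<in> parcs T \<Longrightarrow> edge_stabilizer ?G \<rho> e \<in> \<A>"
    and nopoint: "\<not> (\<exists>p\<in>tree_points T. \<forall>g\<in>carrier ?G. fixes_point \<rho> T g p)"
    using assms(5) unfolding splitting_over_def nontrivial_splitting_def by blast
  interpret splitting ?G T \<rho> by (rule sp)
  interpret G: group ?G by (rule group_G)
  have small: "H \<in> \<A>" if "subgroup H ?G" "(x, y) \<in> parcs T"
    "H \<subseteq> {g \<in> carrier ?G. \<rho> g x = x \<and> \<rho> g y = y}" for H x y
    using assms(4) edges[OF that(2)] that edge_fixator_subset[of x y]
    unfolding closed_under_subgroups_def by blast
  have sep: ?thesis if S: "separated ?V ?E S" "S \<subseteq> ?V" and e: "(x, y) \<in> parcs T"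
    and fixed: "\<And>v. v \<in> S \<Longrightarrow> \<rho> (raag_gen \<Gamma> v) x = x \<and> \<rho> (raag_gen \<Gamma> v) y = y" for S x y
  proof -
    let ?\<Lambda> = "\<lparr>pverts = S, parcs = ?E \<inter> S \<times> S\<rparr>"
    have gens: "raag_gen \<Gamma> ` S \<subseteq> {g \<in> carrier ?G. \<rho> g x = x \<and> \<rho> g y = y}"
      using fixed raag_gen_carrier[OF subsetD[OF S(2)]] by blast
    have "raag_subgroup \<Gamma> ?\<Lambda> \<subseteq> {g \<in> carrier ?G. \<rho> g x = x \<and> \<rho> g y = y}"
      using G.generate_subgroup_incl[OF gens edge_fixator_subgroup] e in_arcsD1 in_arcsD2
      by (simp add: raag_subgroup_def)
    moreover have "subgroup (raag_subgroup \<Gamma> ?\<Lambda>) ?G"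
      using gens unfolding raag_subgroup_def by (intro G.generate_is_subgroup) auto
    ultimately have "raag_subgroup \<Gamma> ?\<Lambda> \<in> \<A>" using small[OF _ e] by blast
    then show ?thesis using separating_induced_subgraph[OF assms(1) S(2,1)] by blast
  qed
  have gen: "carrier ?G \<subseteq> H" if "subgroup H ?G" "raag_gen \<Gamma> ` ?V \<subseteq> H" for H
    using raag_generated[OF that] .
  have comm: "u \<in> ?V \<and> v \<in> ?V \<and> raag_gen \<Gamma> u \<otimes>\<^bsub>?G\<^esub> raag_gen \<Gamma> v = raag_gen \<Gamma> v \<otimes>\<^bsub>?G\<^esub> raag_gen \<Gamma> u"
    if "(u, v) \<in> ?E" for u v
    using raag_gen_commute[OF assms(1) that] \<Gamma>.in_arcsD1[OF that] \<Gamma>.in_arcsD2[OF that] by simp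
  show ?thesis
  proof (cases "\<forall>v\<in>?V. \<exists>x\<in>pverts T. \<rho> (raag_gen \<Gamma> v) x = x")
    case True
    have "\<exists>g\<in>carrier ?G. \<rho> g x \<noteq> x" if "x \<in> pverts T" for x
      using fixed_vertex_point[OF that] nopoint by blast
    then obtain x y where "(x, y) \<in> parcs T"
      and "separated ?V ?E {v \<in> ?V. \<rho> (raag_gen \<Gamma> v) x = x \<and> \<rho> (raag_gen \<Gamma> v) y = y}"
      using elliptic_alternative[OF \<Gamma>.pair_finite_verts raag_gen_carrier gen comm] True by blast
    then show ?thesis by (intro sep) auto
  next
    case False
    then obtain s where s: "s \<in> ?V" and "\<And>x. x \<in> pverts T \<Longrightarrow> \<rho> (raag_gen \<Gamma> s) x \<noteq> x" by blast
    then obtain L l where L: "line L" and l: "0 < l" and t: "translates (\<rho> (raag_gen \<Gamma> s)) L l"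
      using axis_exists[OF raag_gen_carrier[OF s]] by blast
    have e: "(L 0, L 1) \<in> parcs T" using L unfolding line_def by (metis add_0)
    have fixL: "\<rho> g (L 0) = L 0 \<and> \<rho> g (L 1) = L 1" if "translates (\<rho> g) L 0" for g
      using that by (simp add: translates_def)
    consider \<phi> where "\<phi> \<in> hom ?G integer_group"
        "\<forall>g\<in>kernel ?G integer_group \<phi>. translates (\<rho> g) L 0"
      | "separated ?V ?E {v \<in> ?V. translates (\<rho> (raag_gen \<Gamma> v)) L 0}"
      using hyperbolic_alternative[OF raag_gen_carrier gen comm s L t] l by blast
    then show ?thesis
    proof cases
      case 1
      have "subgroup (kernel ?G integer_group \<phi>) ?G"
        using 1(1) by (intro group_hom.subgroup_kernel group_hom.intro)
          (simp_all add: group_hom_axioms_def G.group_axioms)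
      moreover have "kernel ?G integer_group \<phi> \<subseteq> {g \<in> carrier ?G. \<rho> g (L 0) = L 0 \<and> \<rho> g (L 1) = L 1}"
        using 1(2) fixL by (auto simp: kernel_def)
      ultimately show ?thesis using small[OF _ e] 1(1) by blast
    next
      case 2
      then show ?thesis by (rule sep[OF _ _ e]) (auto dest: fixL)
    qed
  qed
qed

end
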